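(* Let $\alpha,\beta\in\Delta$. If $(\alpha|\beta)<0$, then $[x,y]\neq 0$ for all nonzero $x\in\mathfrak g_\alpha$ and $y\in\mathfrak g_\beta$ such that $\mathbb C x\neq\mathbb C y$.
   Context: Let $A=(a_{ij})_{i,j\in I}$ be a symmetrisable generalised Cartan matrix (GCM) indexed by a finite set $I$, and let $\mathfrak g(A)$ be the associated complex Kac–Moody algebra, with Cartan subalgebra $\mathfrak h$, simple roots $\alpha_i\in\mathfrak h^*$ and simple coroots $\alpha_i^\vee\in\mathfrak h$ ($i\in I$), and Chevalley generators $e_i,f_i$. It has the root space decomposition $\mathfrak g(A)=\mathfrak h\oplus\bigoplus_{\alpha\in\Delta}\mathfrak g_\alpha$, where $\mathfrak g_\alpha=\{x:[h,x]=\alpha(h)x\ \forall h\in\mathfrak h\}$ and $\Delta$ is the set of roots (nonzero $\alpha\in\mathfrak h^*$ with $\mathfrak g_\alpha\neq 0$). Let $(\cdot|\cdot)$ be the standard nondegenerate symmetric invariant bilinear form on $\mathfrak g(A)$; its restriction to $\mathfrak h$ is nondegenerate and induces a symmetric bilinear form $(\alpha,\beta)\mapsto(\alpha|\beta)$ on $\mathfrak h^*$. *)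

theory Defs
  imports Complex_Main
begin

definition gcm :: "('i::finite \<Rightarrow> 'i \<Rightarrow> int) \<Rightarrow> bool" where
  "gcm A \<longleftrightarrow> (\<forall>i. A i i = 2) \<and> (\<forall>i j. i \<noteq> j \<longrightarrow> A i j \<le> 0)
     \<and> (\<forall>i j. A i j = 0 \<longleftrightarrow> A j i = 0)"

definition symmetrisable :: "('i::finite \<Rightarrow> 'i \<Rightarrow> int) \<Rightarrow> bool" where
  "symmetrisable A \<longleftrightarrow> (\<exists>(d::'i \<Rightarrow> real) (b::'i \<Rightarrow> 'i \<Rightarrow> real).
      (\<forall>i. d i > 0) \<and> (\<forall>i j. b i j = b j i) \<and> (\<forall>i j. real_of_int (A i j) = d i * b i j))"

definition rows_independent :: "('i::finite \<Rightarrow> 'i \<Rightarrow> int) \<Rightarrow> 'i set \<Rightarrow> bool" where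
  "rows_independent A J \<longleftrightarrow> (\<forall>c::'i \<Rightarrow> complex.
      (\<forall>j. (\<Sum>i\<in>J. c i * of_int (A i j)) = 0) \<longrightarrow> (\<forall>i\<in>J. c i = 0))"

definition gcm_rank :: "('i::finite \<Rightarrow> 'i \<Rightarrow> int) \<Rightarrow> nat" where
  "gcm_rank A = Max {card J | J. rows_independent A J}"

definition lie_algebra :: "(complex \<Rightarrow> 'g::ab_group_add \<Rightarrow> 'g) \<Rightarrow> ('g \<Rightarrow> 'g \<Rightarrow> 'g) \<Rightarrow> bool" where
  "lie_algebra sc br \<longleftrightarrow> vector_space sc \<and>
     (\<forall>x y z. br (x + y) z = br x z + br y z) \<and>
     (\<forall>x y z. br x (y + z) = br x y + br x z) \<and>
     (\<forall>a x y. br (sc a x) y = sc a (br x y)) \<and>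
     (\<forall>a x y. br x (sc a y) = sc a (br x y)) \<and>
     (\<forall>x. br x x = 0) \<and>
     (\<forall>x y z. br x (br y z) + br y (br z x) + br z (br x y) = 0)"

definition lie_subalgebra :: "(complex \<Rightarrow> 'g::ab_group_add \<Rightarrow> 'g) \<Rightarrow> ('g \<Rightarrow> 'g \<Rightarrow> 'g) \<Rightarrow> 'g set \<Rightarrow> bool" where
  "lie_subalgebra sc br S \<longleftrightarrow> module.subspace sc S \<and> (\<forall>x\<in>S. \<forall>y\<in>S. br x y \<in> S)"

definition lie_ideal :: "(complex \<Rightarrow> 'g::ab_group_add \<Rightarrow> 'g) \<Rightarrow> ('g \<Rightarrow> 'g \<Rightarrow> 'g) \<Rightarrow> 'g set \<Rightarrow> bool" where
  "lie_ideal sc br S \<longleftrightarrow> module.subspace sc S \<and> (\<forall>x\<in>S. \<forall>y. br y x \<in> S)"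

definition realization ::
  "('i::finite \<Rightarrow> 'i \<Rightarrow> int) \<Rightarrow> (complex \<Rightarrow> 'g::ab_group_add \<Rightarrow> 'g) \<Rightarrow> 'g set
     \<Rightarrow> ('i \<Rightarrow> 'g \<Rightarrow> complex) \<Rightarrow> ('i \<Rightarrow> 'g) \<Rightarrow> bool" where
  "realization A sc H alpha coroot \<longleftrightarrow>
     module.subspace sc H \<and>
     (\<exists>B. finite B \<and> B \<subseteq> H \<and> module.span sc B = H) \<and>
     vector_space.dim sc H = 2 * card (UNIV::'i set) - gcm_rank A \<and>
     (\<forall>i. \<forall>h\<in>H. \<forall>k\<in>H. \<forall>c. alpha i (h + k) = alpha i h + alpha i k \<and> alpha i (sc c h) = c * alpha i h) \<and>
     (\<forall>c::'i \<Rightarrow> complex. (\<forall>h\<in>H. (\<Sum>i\<in>UNIV. c i * alpha i h) = 0) \<longrightarrow> (\<forall>i. c i = 0)) \<and>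
     (\<forall>i. coroot i \<in> H) \<and>
     (\<forall>c::'i \<Rightarrow> complex. (\<Sum>i\<in>UNIV. sc (c i) (coroot i)) = 0 \<longrightarrow> (\<forall>i. c i = 0)) \<and>
     (\<forall>i j. alpha j (coroot i) = of_int (A i j))"

(* (g, br, H, alpha, coroot, e, f) is (isomorphic to) the Kac-Moody algebra g(A):
   generated by e_i, f_i, H subject to the defining relations, and with no nonzero ideal
   meeting H trivially (i.e. the quotient of g~(A) by its maximal such ideal). *)
definition kac_moody ::
  "('i::finite \<Rightarrow> 'i \<Rightarrow> int) \<Rightarrow> (complex \<Rightarrow> 'g::ab_group_add \<Rightarrow> 'g) \<Rightarrow> ('g \<Rightarrow> 'g \<Rightarrow> 'g) \<Rightarrow> 'g set
     \<Rightarrow> ('i \<Rightarrow> 'g \<Rightarrow> complex) \<Rightarrow> ('i \<Rightarrow> 'g) \<Rightarrow> ('i \<Rightarrow> 'g) \<Rightarrow> ('i \<Rightarrow> 'g) \<Rightarrow> bool" where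
  "kac_moody A sc br H alpha coroot e f \<longleftrightarrow>
     lie_algebra sc br \<and> realization A sc H alpha coroot \<and>
     (\<forall>i j. br (e i) (f j) = (if i = j then coroot i else 0)) \<and>
     (\<forall>h\<in>H. \<forall>k\<in>H. br h k = 0) \<and>
     (\<forall>i. \<forall>h\<in>H. br h (e i) = sc (alpha i h) (e i)) \<and>
     (\<forall>i. \<forall>h\<in>H. br h (f i) = sc (- alpha i h) (f i)) \<and>
     (\<forall>S. lie_subalgebra sc br S \<and> H \<subseteq> S \<and> range e \<subseteq> S \<and> range f \<subseteq> S \<longrightarrow> S = UNIV) \<and>
     (\<forall>J. lie_ideal sc br J \<and> J \<inter> H = {0} \<longrightarrow> J = {0})"

(* root spaces and roots; elements of h^* are represented by functions 'g \<Rightarrow> complex,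
   only their values on H matter *)
definition root_space :: "(complex \<Rightarrow> 'g \<Rightarrow> 'g) \<Rightarrow> ('g \<Rightarrow> 'g \<Rightarrow> 'g) \<Rightarrow> 'g set \<Rightarrow> ('g \<Rightarrow> complex) \<Rightarrow> 'g set" where
  "root_space sc br H a = {x. \<forall>h\<in>H. br h x = sc (a h) x}"

definition roots :: "(complex \<Rightarrow> 'g::ab_group_add \<Rightarrow> 'g) \<Rightarrow> ('g \<Rightarrow> 'g \<Rightarrow> 'g) \<Rightarrow> 'g set \<Rightarrow> ('g \<Rightarrow> complex) set" where
  "roots sc br H = {a. (\<forall>h\<in>H. \<forall>k\<in>H. \<forall>c. a (h + k) = a h + a k \<and> a (sc c h) = c * a h)
                      \<and> (\<exists>h\<in>H. a h \<noteq> 0) \<and> root_space sc br H a \<noteq> {0}}"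

(* standard nondegenerate symmetric invariant bilinear form (Kac (2.1.2)):
   (coroot_i | h) = eps_i * alpha_i(h) with eps_i > 0 *)
definition standard_form ::
  "(complex \<Rightarrow> 'g::ab_group_add \<Rightarrow> 'g) \<Rightarrow> ('g \<Rightarrow> 'g \<Rightarrow> 'g) \<Rightarrow> 'g set
     \<Rightarrow> ('i::finite \<Rightarrow> 'g \<Rightarrow> complex) \<Rightarrow> ('i \<Rightarrow> 'g) \<Rightarrow> ('g \<Rightarrow> 'g \<Rightarrow> complex) \<Rightarrow> bool" where
  "standard_form sc br H alpha coroot Bf \<longleftrightarrow>
     (\<forall>x y z. Bf (x + y) z = Bf x z + Bf y z) \<and>
     (\<forall>a x y. Bf (sc a x) y = a * Bf x y) \<and>
     (\<forall>x y. Bf x y = Bf y x) \<and>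
     (\<forall>x y z. Bf (br x y) z = Bf x (br y z)) \<and>
     (\<forall>x. (\<forall>y. Bf x y = 0) \<longrightarrow> x = 0) \<and>
     (\<forall>x\<in>H. (\<forall>y\<in>H. Bf x y = 0) \<longrightarrow> x = 0) \<and>
     (\<exists>eps::'i \<Rightarrow> real. (\<forall>i. eps i > 0) \<and>
        (\<forall>i. \<forall>h\<in>H. Bf (coroot i) h = of_real (eps i) * alpha i h))"

definition nu_inv :: "'g set \<Rightarrow> ('g \<Rightarrow> 'g \<Rightarrow> complex) \<Rightarrow> ('g \<Rightarrow> complex) \<Rightarrow> 'g" where
  "nu_inv H Bf a = (THE t. t \<in> H \<and> (\<forall>h\<in>H. Bf t h = a h))"

definition form_star :: "'g set \<Rightarrow> ('g \<Rightarrow> 'g \<Rightarrow> complex) \<Rightarrow> ('g \<Rightarrow> complex) \<Rightarrow> ('g \<Rightarrow> complex) \<Rightarrow> complex" where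
  "form_star H Bf a b = Bf (nu_inv H Bf a) (nu_inv H Bf b)"

end

theory Submission
  imports Defs "HOL-Library.Function_Algebras" "HOL-Library.FuncSet"
begin

text \<open>Let \<open>\<omega>\<close> be the compact antilinear involution of \<open>\<gg>(A)\<close>. For \<open>x \<in> \<gg>\<^sub>\<alpha>\<close> and \<open>y \<in> \<gg>\<^sub>\<beta>\<close>, invariance of the
  form gives, with \<open>N(z) = -(z|\<omega> z)\<close>,
  \<open>N([x, y]) = N([x, \<omega> y]) - (\<alpha>|\<beta>) N(x) N(y)\<close>.
  Since \<open>N\<close> is positive definite on every root space, the right-hand side is positive if
  \<open>\<alpha> \<noteq> \<beta>\<close> and \<open>(\<alpha>|\<beta>) < 0\<close>. If \<open>\<alpha> = \<beta>\<close>, then \<open>[x, \<omega> y]\<close> is a multiple of \<open>\<nu>\<^sup>-\<^sup>1(\<alpha>)\<close> and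
  \<open>N([x, y])\<close> is positive by the strict Cauchy-Schwarz inequality.
  Positivity of \<open>N\<close> is Kac's argument by induction on the height: the Casimir identity yields
  \<open>(2(\<rho>|\<beta>) - (\<beta>|\<beta>)) N(x) = \<Sum> N([f\<^sub>\<gamma>, x])\<close>, the sum being over orthonormal bases of the lower
  root spaces, and the scalar on the left is positive for nonsimple positive roots \<open>\<beta>\<close>.\<close>

text \<open>The hypotheses give the algebra by generation and by the absence of nonzero ideals that
  miss \<open>H\<close>, so vanishing has one source: a vector of positive height killed by every
  \<open>f i\<close> is zero (\<open>annihilated_zero\<close>). The Serre relations,
  single-valuedness of the involution and the Casimir identity all rest on it. The scalar 2(rho|k) -
  (k|k) is controlled by simple reflections: if (alpha_i|k) > 0, reflecting lowers both height and
  scalar; if this holds for no i, then (k|k) <= 0 while 2(rho|k) > 0. Only strings through a single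
  simple root enter, hence the small amount of sl2 theory. Statements on negative weights come from
  a second interpretation of the locale with \<open>e\<close> and \<open>f\<close> exchanged. In
  weight zero the involution is defined only on the span of the coroots and N is not known to be
  positive there; so alpha = beta, where [x, om y] lies in \<open>H\<close>, is a separate
  case.\<close>

section \<open>Weights\<close>

text \<open>Unification leaves weights eta-expanded, and these rules would then rewrite
  a sum of weights to an abstraction.\<close>
declare plus_fun_apply [simp del] zero_fun_apply [simp del] minus_apply [simp del] uminus_apply [simp del]

lemmas wt_apply = plus_fun_apply zero_fun_apply minus_apply uminus_apply

text \<open>An element of the root lattice is its coordinate function on the simple roots, so
  \<open>unit_wt i\<close> is alpha_i; under the pointwise order \<open>0 < k\<close> then says that
  k is a nonempty sum of simple roots.\<close>

definition unit_wt :: "'i \<Rightarrow> 'i \<Rightarrow> int" where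
  "unit_wt i = (\<lambda>j. if j = i then 1 else 0)"

definition ht :: "('i::finite \<Rightarrow> int) \<Rightarrow> int" where
  "ht k = (\<Sum>i\<in>UNIV. k i)"

lemma ht_add: "ht (k + l) = ht k + ht l"
  by (simp add: ht_def wt_apply sum.distrib)

lemma ht_minus: "ht (- k) = - ht k"
  by (simp add: ht_def wt_apply sum_negf)

lemma ht_diff: "ht (k - l) = ht k - ht l"
  by (simp add: ht_def wt_apply sum_subtractf)

lemma ht_unit_wt [simp]: "ht (unit_wt i) = 1"
  by (simp add: ht_def wt_apply unit_wt_def)

lemma ht_0 [simp]: "ht 0 = 0"
  by (simp add: ht_def wt_apply)

definition shift :: "'i \<Rightarrow> int \<Rightarrow> ('i \<Rightarrow> int) \<Rightarrow> 'i \<Rightarrow> int" where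
  "shift i n k = (\<lambda>j. if j = i then k j + n else k j)"

lemma shift_0 [simp]: "shift i 0 k = k"
  by (auto simp: shift_def)

lemma shift_shift [simp]: "shift i m (shift i n k) = shift i (m + n) k"
  by (auto simp: shift_def)

lemma add_unit_wt: "unit_wt i + k = shift i 1 k"
  by (auto simp: shift_def unit_wt_def wt_apply)

lemma diff_unit_wt: "k - unit_wt i = shift i (- 1) k"
  by (auto simp: shift_def unit_wt_def wt_apply)

lemma sum_shift:
  fixes c :: "'i::finite \<Rightarrow> 'a::comm_ring_1"
  shows "(\<Sum>j\<in>UNIV. c j * of_int (shift i n k j)) = (\<Sum>j\<in>UNIV. c j * of_int (k j)) + of_int n * c i"
proof -
  have "(\<Sum>j\<in>UNIV. c j * of_int (shift i n k j)) = (\<Sum>j\<in>UNIV. c j * of_int (k j) + (if j = i then c j * of_int n else 0))"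
    by (rule sum.cong) (auto simp: shift_def algebra_simps)
  then show ?thesis by (simp add: sum.distrib)
qed

lemma ht_shift [simp]: "ht (shift i n k) = ht k + n"
  using sum_shift[of "\<lambda>_. 1::int" i n k] by (simp add: ht_def)

lemma unit_wt_pos: "0 < unit_wt i"
  by (auto simp: less_fun_def le_fun_def unit_wt_def wt_apply)

lemma pos_wt_iff: "0 < (k::'i \<Rightarrow> int) \<longleftrightarrow> (\<forall>i. 0 \<le> k i) \<and> (\<exists>i. 0 < k i)"
  unfolding less_fun_def le_fun_def by (simp add: not_le wt_apply)

lemma ht_pos: assumes "0 < k" shows "0 < ht k"
proof -
  obtain i where "0 < k i" "\<forall>i. 0 \<le> k i" using assms unfolding pos_wt_iff by auto
  then show ?thesis unfolding ht_def by (intro sum_pos2[of UNIV i]) auto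
qed

lemma add_unit_wt_pos: "0 < k \<Longrightarrow> 0 < k + unit_wt i"
  unfolding pos_wt_iff plus_fun_apply unit_wt_def by (auto intro: add_nonneg_pos)

lemma finite_between: "finite {g::'i::finite \<Rightarrow> int. 0 < g \<and> 0 < k - g}"
proof (rule finite_subset)
  show "{g. 0 < g \<and> 0 < k - g} \<subseteq> Pi\<^sub>E UNIV (\<lambda>i. {0..k i})"
    by (auto simp: pos_wt_iff wt_apply PiE_iff)
  show "finite (Pi\<^sub>E UNIV (\<lambda>i. {0..k i}))"
    by (intro finite_PiE) auto
qed

lemma pos_wt_add: "0 < (k::'i \<Rightarrow> int) \<Longrightarrow> 0 < l \<Longrightarrow> 0 < k + l"
  unfolding pos_wt_iff wt_apply by (meson add_nonneg_nonneg add_pos_nonneg)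

lemma ht_1: assumes k: "0 < k" "ht k = 1" shows "\<exists>i. k = unit_wt i"
proof -
  obtain i where i: "0 < k i" and nn: "\<And>j. 0 \<le> k j" using k(1) by (auto simp: pos_wt_iff)
  have nn': "0 \<le> (k - unit_wt i) j" for j using i nn[of j] by (simp add: wt_apply unit_wt_def)
  have "k = unit_wt i"
  proof (rule ccontr)
    assume "k \<noteq> unit_wt i"
    then obtain j where "k j \<noteq> unit_wt i j" by blast
    then have "0 < (k - unit_wt i) j" using nn'[of j] by (simp add: wt_apply)
    then have "0 < k - unit_wt i" using nn' unfolding pos_wt_iff by blast
    then show False using ht_pos[of "k - unit_wt i"] k(2) by (simp add: ht_diff)
  qed
  then show ?thesis ..
qed

lemma pos_wt_asym: "0 < (k::'i::finite \<Rightarrow> int) \<Longrightarrow> \<not> 0 < - k"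
  using ht_pos[of k] ht_pos[of "- k"] by (auto simp: ht_minus)

section \<open>Weight spaces\<close>

text \<open>The defining conditions are listed one by one so that the locale can be interpreted a
  second time, with \<open>e\<close> and \<open>f\<close> exchanged and the signs of roots and
  coroots reversed.\<close>

locale kac_moody_algebra = vector_space sc for sc :: "complex \<Rightarrow> 'g::ab_group_add \<Rightarrow> 'g" +
  fixes A :: "'i::finite \<Rightarrow> 'i \<Rightarrow> int"
    and br :: "'g \<Rightarrow> 'g \<Rightarrow> 'g"
    and H :: "'g set"
    and alpha :: "'i \<Rightarrow> 'g \<Rightarrow> complex"
    and coroot e f :: "'i \<Rightarrow> 'g"
  assumes br_add_l: "br (x + y) z = br x z + br y z"
    and br_add_r: "br x (y + z) = br x y + br x z"
    and br_sc_l: "br (sc a x) y = sc a (br x y)"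
    and br_sc_r: "br x (sc a y) = sc a (br x y)"
    and br_self [simp]: "br x x = 0"
    and jacobi: "br x (br y z) + br y (br z x) + br z (br x y) = 0"
    and H_subspace: "subspace H"
    and alpha_add: "h \<in> H \<Longrightarrow> h' \<in> H \<Longrightarrow> alpha i (h + h') = alpha i h + alpha i h'"
    and alpha_sc: "h \<in> H \<Longrightarrow> alpha i (sc c h) = c * alpha i h"
    and alpha_indep: "(\<And>h. h \<in> H \<Longrightarrow> (\<Sum>i\<in>UNIV. cf i * alpha i h) = 0) \<Longrightarrow> cf i = 0"
    and coroot_H: "coroot i \<in> H"
    and coroot_indep: "(\<Sum>i\<in>UNIV. sc (cf i) (coroot i)) = 0 \<Longrightarrow> cf i = 0"
    and alpha_coroot: "alpha j (coroot i) = of_int (A i j)"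
    and br_ef: "br (e i) (f j) = (if i = j then coroot i else 0)"
    and br_HH: "h \<in> H \<Longrightarrow> h' \<in> H \<Longrightarrow> br h h' = 0"
    and br_He: "h \<in> H \<Longrightarrow> br h (e i) = sc (alpha i h) (e i)"
    and br_Hf: "h \<in> H \<Longrightarrow> br h (f i) = sc (- alpha i h) (f i)"
    and generated: "lie_subalgebra sc br S \<Longrightarrow> H \<subseteq> S \<Longrightarrow> range e \<subseteq> S \<Longrightarrow> range f \<subseteq> S \<Longrightarrow> S = UNIV"
    and no_ideal: "lie_ideal sc br J \<Longrightarrow> J \<inter> H = {0} \<Longrightarrow> J = {0}"
    and A_diag: "A i i = 2"
    and A_offdiag: "i \<noteq> j \<Longrightarrow> A i j \<le> 0"
    and A_zero: "A i j = 0 \<Longrightarrow> A j i = 0"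
begin

lemma br_0_l [simp]: "br 0 x = 0"
  using br_sc_l[of 0 0 x] by simp

lemma br_0_r [simp]: "br x 0 = 0"
  using br_sc_r[of x 0 0] by simp

lemma br_minus_l: "br (- x) y = - br x y"
  using br_sc_l[of "-1" x y] by simp

lemma br_minus_r: "br x (- y) = - br x y"
  using br_sc_r[of x "-1" y] by simp

lemma br_diff_r: "br z (x - y) = br z x - br z y"
  using br_add_r[of z x "-y"] by (simp add: br_minus_r)

lemma br_sum_l: "br (sum g S) x = (\<Sum>s\<in>S. br (g s) x)"
  by (induction S rule: infinite_finite_induct) (auto simp: br_add_l)

lemma br_sum_r: "br x (sum g S) = (\<Sum>s\<in>S. br x (g s))"
  by (induction S rule: infinite_finite_induct) (auto simp: br_add_r)

lemma br_anti: "br x y = - br y x"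
proof -
  have "br (x + y) (x + y) = 0" by simp
  then have "br x y + br y x = 0" unfolding br_add_l br_add_r by (simp add: add.commute)
  then show ?thesis by (simp add: eq_neg_iff_add_eq_0)
qed

lemma br_leibniz: "br x (br y z) = br (br x y) z + br y (br x z)"
proof -
  have "br x (br y z) = - br y (br z x) - br z (br x y)"
    using jacobi[of x y z] by (simp add: algebra_simps eq_neg_iff_add_eq_0)
  also have "br z (br x y) = - br (br x y) z" by (rule br_anti)
  also have "br y (br z x) = - br y (br x z)" by (metis br_anti br_minus_r)
  finally show ?thesis by simp
qed

lemma br_fe: "br (f i) (e j) = (if i = j then - coroot i else 0)"
  using br_anti[of "f i" "e j"] br_ef[of j i] by auto

text \<open>By Leibniz the elements whose adjoint action preserves \<open>S\<close> form a
  subalgebra; containing \<open>H\<close> and all generators, it is everything.\<close>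

lemma generated_ideal:
  assumes S: "subspace S"
    and "\<And>h x. h \<in> H \<Longrightarrow> x \<in> S \<Longrightarrow> br h x \<in> S"
    and "\<And>i x. x \<in> S \<Longrightarrow> br (e i) x \<in> S"
    and "\<And>i x. x \<in> S \<Longrightarrow> br (f i) x \<in> S"
  shows "x \<in> S \<Longrightarrow> br y x \<in> S"
proof -
  let ?N = "{y. \<forall>x\<in>S. br y x \<in> S}"
  have "br (br y z) x \<in> S" if "y \<in> ?N" "z \<in> ?N" "x \<in> S" for x y z
  proof -
    have "br (br y z) x = br y (br z x) - br z (br y x)"
      using br_leibniz[of y z x] by simp
    then show ?thesis using that S by (auto intro: subspace_diff)
  qed
  moreover have "subspace ?N"
    using S by (auto simp: subspace_def br_add_l br_sc_l)
  ultimately have "lie_subalgebra sc br ?N"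
    by (auto simp: lie_subalgebra_def)
  then have "?N = UNIV"
    using assms(2-4) by (intro generated) auto
  then show "x \<in> S \<Longrightarrow> br y x \<in> S" by blast
qed

definition wt :: "('i \<Rightarrow> int) \<Rightarrow> 'g \<Rightarrow> complex" where
  "wt k h = (\<Sum>i\<in>UNIV. of_int (k i) * alpha i h)"

definition G :: "('i \<Rightarrow> int) \<Rightarrow> 'g set" where
  "G k = root_space sc br H (wt k)"

lemma wt_add: "wt (k + l) h = wt k h + wt l h"
  by (simp add: wt_def wt_apply sum.distrib algebra_simps)

lemma wt_minus: "wt (- k) h = - wt k h"
  by (simp add: wt_def wt_apply sum_negf)

lemma wt_0 [simp]: "wt 0 h = 0"
  by (simp add: wt_def wt_apply)

lemma wt_unit [simp]: "wt (unit_wt i) h = alpha i h"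
proof -
  have "wt (unit_wt i) h = (\<Sum>j\<in>UNIV. if j = i then alpha j h else 0)"
    unfolding wt_def by (rule sum.cong) (auto simp: unit_wt_def)
  then show ?thesis by simp
qed

lemma wt_distinct:
  assumes "k \<noteq> l" shows "\<exists>h\<in>H. wt k h \<noteq> wt l h"
proof (rule ccontr)
  assume "\<not> ?thesis"
  then have *: "h \<in> H \<Longrightarrow> (\<Sum>i\<in>UNIV. (of_int (k i) - of_int (l i)) * alpha i h) = 0" for h
    by (simp add: wt_def wt_apply left_diff_distrib sum_subtractf)
  have "of_int (k i) - of_int (l i) = (0::complex)" for i
    by (rule alpha_indep[of "\<lambda>i. of_int (k i) - of_int (l i)", OF *])
  then have "k i = l i" for i by simp
  then show False using assms by auto
qed

lemma root_space_iff: "x \<in> root_space sc br H w \<longleftrightarrow> (\<forall>h\<in>H. br h x = sc (w h) x)"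
  by (simp add: root_space_def)

lemma subspace_root_space: "subspace (root_space sc br H w)"
  by (auto simp: subspace_def root_space_iff br_add_r br_sc_r scale_right_distrib scale_left_commute)

lemma G_iff: "x \<in> G k \<longleftrightarrow> (\<forall>h\<in>H. br h x = sc (wt k h) x)"
  by (simp add: G_def root_space_iff)

lemma br_H_G: "x \<in> G k \<Longrightarrow> h \<in> H \<Longrightarrow> br h x = sc (wt k h) x"
  by (simp add: G_iff)

lemma subspace_G: "subspace (G k)"
  unfolding G_def by (rule subspace_root_space)

lemma G_br: "x \<in> G k \<Longrightarrow> y \<in> G l \<Longrightarrow> br x y \<in> G (k + l)"
  by (simp add: G_iff br_leibniz[of _ x y] br_sc_l br_sc_r wt_add scale_left_distrib)

lemma e_G: "e i \<in> G (unit_wt i)"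
  by (simp add: G_iff br_He)

lemma f_G: "f i \<in> G (- unit_wt i)"
  by (simp add: G_iff br_Hf wt_minus)

lemma H_G: "H \<subseteq> G 0"
  by (auto simp: G_iff br_HH)

text \<open>The index type is arbitrary, so that \<open>root_space_W\<close> can add one further
  functional to a family of lattice weights.\<close>

lemma indep_weights:
  assumes "finite J"
    and "\<And>j. j \<in> J \<Longrightarrow> X j \<in> root_space sc br H (w j)"
    and "\<And>i j. i \<in> J \<Longrightarrow> j \<in> J \<Longrightarrow> i \<noteq> j \<Longrightarrow> \<exists>h\<in>H. w i h \<noteq> w j h"
    and "sum X J = 0"
    and "j \<in> J"
  shows "X j = 0"
  using assms
proof (induction J arbitrary: X j rule: finite_induct)
  case empty
  then show ?case by simp
next
  case (insert a J)
  have J0: "X i = 0" if i: "i \<in> J" for i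
  proof -
    have "i \<noteq> a" using i insert.hyps by auto
    then obtain h where h: "h \<in> H" "w i h \<noteq> w a h" using insert.prems(2)[of i a] i by auto
    \<comment> \<open>Applying ad h minus the scalar \<open>w a h\<close> removes the summand at
      \<open>a\<close> and multiplies the one at \<open>i\<close> by a nonzero number, so the
      induction hypothesis for \<open>J\<close> applies.\<close>
    define Y where "Y j = sc (w j h - w a h) (X j)" for j
    have hX: "br h (X j) = sc (w j h) (X j)" if "j \<in> insert a J" for j
      using insert.prems(1)[OF that] h by (simp add: root_space_iff)
    have "sum Y (insert a J) = (\<Sum>j\<in>insert a J. br h (X j) - sc (w a h) (X j))"
      by (rule sum.cong) (auto simp: Y_def hX scale_left_diff_distrib)
    also have "\<dots> = br h (sum X (insert a J)) - sc (w a h) (sum X (insert a J))"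
      unfolding br_sum_r scale_sum_right by (rule sum_subtractf)
    also have "\<dots> = 0" using insert.prems(3) by simp
    finally have "sum Y J = 0" using insert.hyps by (simp add: Y_def)
    moreover have "Y j \<in> root_space sc br H (w j)" if "j \<in> J" for j
      unfolding Y_def using insert.prems(1)[of j] that by (intro subspace_scale[OF subspace_root_space]) auto
    ultimately have "Y i = 0" using insert.IH[of Y i] insert.prems(2) i by blast
    then show ?thesis using h by (simp add: Y_def)
  qed
  moreover have "X a = 0"
    using insert.prems(3) insert.hyps J0 by simp
  ultimately show ?case using insert.prems(4) by auto
qed

lemma G_indep:
  assumes "finite K" "\<And>k. k \<in> K \<Longrightarrow> X k \<in> G k" "sum X K = 0" "k \<in> K"
  shows "X k = 0"
  using indep_weights[of K X wt k] assms wt_distinct by (auto simp: G_def)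

lemma span_graded:
  assumes V: "\<And>k. k \<in> S \<Longrightarrow> subspace (V k)" and x: "x \<in> span (\<Union>k\<in>S. V k)"
  shows "\<exists>K X. finite K \<and> K \<subseteq> S \<and> (\<forall>k\<in>K. X k \<in> V k) \<and> x = sum X K"
  using x
proof (induction rule: span_induct)
  case (base)
  show ?case
  proof (unfold subspace_def, intro conjI ballI allI, simp_all only: mem_Collect_eq)
    show "\<exists>K X. finite K \<and> K \<subseteq> S \<and> (\<forall>k\<in>K. X k \<in> V k) \<and> 0 = sum X K"
      by (rule exI[of _ "{}"]) auto
  next
    fix x y
    assume "\<exists>K X. finite K \<and> K \<subseteq> S \<and> (\<forall>k\<in>K. X k \<in> V k) \<and> x = sum X K"
    then obtain K X where X: "finite K" "K \<subseteq> S" "\<forall>k\<in>K. X k \<in> V k" "x = sum X K" by blast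
    assume "\<exists>K X. finite K \<and> K \<subseteq> S \<and> (\<forall>k\<in>K. X k \<in> V k) \<and> y = sum X K"
    then obtain L Y where Y: "finite L" "L \<subseteq> S" "\<forall>k\<in>L. Y k \<in> V k" "y = sum Y L" by blast
    define X' where "X' k = (if k \<in> K then X k else 0)" for k
    define Y' where "Y' k = (if k \<in> L then Y k else 0)" for k
    have "x = sum X' (K \<union> L)"
      unfolding X(4) X'_def using X(1) Y(1) by (intro sum.mono_neutral_cong_left) auto
    moreover have "y = sum Y' (K \<union> L)"
      unfolding Y(4) Y'_def using X(1) Y(1) by (intro sum.mono_neutral_cong_left) auto
    moreover have "X' k + Y' k \<in> V k" if "k \<in> K \<union> L" for k
      using that X(2,3) Y(2,3) V[of k] unfolding X'_def Y'_def
      by (intro subspace_add) (auto intro: subspace_0)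
    ultimately show "\<exists>K X. finite K \<and> K \<subseteq> S \<and> (\<forall>k\<in>K. X k \<in> V k) \<and> x + y = sum X K"
      using X Y by (intro exI[of _ "K \<union> L"] exI[of _ "\<lambda>k. X' k + Y' k"]) (auto simp: sum.distrib)
  next
    fix c x
    assume "\<exists>K X. finite K \<and> K \<subseteq> S \<and> (\<forall>k\<in>K. X k \<in> V k) \<and> x = sum X K"
    then obtain K X where X: "finite K" "K \<subseteq> S" "\<forall>k\<in>K. X k \<in> V k" "x = sum X K" by blast
    then show "\<exists>K X. finite K \<and> K \<subseteq> S \<and> (\<forall>k\<in>K. X k \<in> V k) \<and> sc c x = sum X K"
      using V by (intro exI[of _ K] exI[of _ "\<lambda>k. sc c (X k)"])
        (auto simp: scale_sum_right intro!: subspace_scale)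
  qed
next
  case (step x)
  then obtain k where "k \<in> S" "x \<in> V k" by auto
  then show ?case by (intro exI[of _ "{k}"] exI[of _ "\<lambda>_. x"]) auto
qed

text \<open>The smallest subspace containing \<open>x\<close> and stable under all
  \<open>e i\<close> is already an ideal. It is spanned within weights of positive height, so it
  misses \<open>H\<close> and must be zero.\<close>

lemma annihilated_zero:
  assumes x: "x \<in> G k" and k: "0 < ht k" and fx: "\<And>i. br (f i) x = 0"
  shows "x = 0"
proof -
  define \<S> where "\<S> = {S. subspace S \<and> x \<in> S \<and> (\<forall>i. \<forall>z\<in>S. br (e i) z \<in> S)}"
  define J where "J = \<Inter>\<S>"
  have J: "subspace J" unfolding J_def by (rule subspace_Inter) (simp add: \<S>_def)
  have xJ: "x \<in> J" by (simp add: J_def \<S>_def)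
  have eJ: "br (e i) z \<in> J" if "z \<in> J" for i z
    using that unfolding J_def \<S>_def by simp
  have Jind: "J \<subseteq> S" if "subspace S" "x \<in> S" "\<And>i z. z \<in> S \<Longrightarrow> br (e i) z \<in> S" for S
    unfolding J_def by (rule Inter_lower) (simp add: \<S>_def that)
  have hJ: "br h z \<in> J" if "h \<in> H" "z \<in> J" for h z
  proof -
    have "J \<subseteq> {z\<in>J. br h z \<in> J}"
    proof (rule Jind)
      show "subspace {z\<in>J. br h z \<in> J}"
        using J by (auto simp: subspace_def br_add_r br_sc_r)
      show "x \<in> {z\<in>J. br h z \<in> J}"
        using xJ br_H_G[OF x that(1)] subspace_scale[OF J] by auto
      show "br (e i) z \<in> {z\<in>J. br h z \<in> J}" if "z \<in> {z\<in>J. br h z \<in> J}" for i z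
        using that eJ br_He[OF \<open>h \<in> H\<close>, of i] J
        by (auto simp: br_leibniz[of h "e i" z] br_sc_l intro!: subspace_add subspace_scale)
    qed
    then show ?thesis using that by blast
  qed
  have fJ: "br (f i) z \<in> J" if "z \<in> J" for i z
  proof -
    have "J \<subseteq> {z\<in>J. br (f i) z \<in> J}"
    proof (rule Jind)
      show "subspace {z\<in>J. br (f i) z \<in> J}"
        using J by (auto simp: subspace_def br_add_r br_sc_r)
      show "x \<in> {z\<in>J. br (f i) z \<in> J}"
        using xJ fx subspace_0[OF J] by auto
      show "br (e j) z \<in> {z\<in>J. br (f i) z \<in> J}" if "z \<in> {z\<in>J. br (f i) z \<in> J}" for j z
        using that eJ hJ[OF coroot_H, of z i] J
        by (auto simp: br_leibniz[of "f i" "e j" z] br_fe br_minus_l intro!: subspace_add subspace_neg subspace_diff)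
    qed
    then show ?thesis using that by blast
  qed
  have "lie_ideal sc br J"
    unfolding lie_ideal_def using J generated_ideal[OF J hJ eJ fJ] by blast
  moreover have "J \<inter> H = {0}"
  proof -
    have sub: "J \<subseteq> span (\<Union>k\<in>{k. 0 < ht k}. G k)" (is "_ \<subseteq> span ?U")
    proof (rule Jind)
      show "x \<in> span ?U" using x k by (auto intro: span_base)
      show "br (e i) z \<in> span ?U" if "z \<in> span ?U" for i z
        using that
      proof (induction rule: span_induct)
        case base
        show ?case using subspace_span[of ?U] by (auto simp: subspace_def br_add_r br_sc_r)
      next
        case (step z)
        then obtain l where "0 < ht l" "z \<in> G l" by auto
        then have "br (e i) z \<in> G (unit_wt i + l)" "0 < ht (unit_wt i + l)"
          using G_br[OF e_G] by (auto simp: ht_add)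
        then show ?case by (auto intro!: span_base)
      qed
    qed auto
    have "z = 0" if "z \<in> J" "z \<in> H" for z
    proof -
      obtain K X where X: "finite K" "K \<subseteq> {k. 0 < ht k}" "\<forall>k\<in>K. X k \<in> G k" "z = sum X K"
        using span_graded[of "{k. 0 < ht k}" G z] subspace_G sub \<open>z \<in> J\<close> by blast
      have 0: "0 \<notin> K" using X(2) by auto
      \<comment> \<open>Entering \<open>- z\<close> at weight 0 turns the expansion of
        \<open>z\<close> into a relation among vectors of distinct weights.\<close>
      define Y where "Y k = (if k = 0 then - z else X k)" for k
      have "sum Y K = sum X K" unfolding Y_def using 0 by (intro sum.cong) auto
      then have "sum Y (insert 0 K) = 0" using X(1,4) 0 by (simp add: Y_def)
      moreover have "Y k \<in> G k" if "k \<in> insert 0 K" for k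
        using that X(3) \<open>z \<in> H\<close> H_G subspace_neg[OF subspace_G] by (auto simp: Y_def)
      ultimately have "Y 0 = 0" using G_indep[of "insert 0 K" Y 0] X(1) by blast
      then show ?thesis by (simp add: Y_def)
    qed
    then show ?thesis using subspace_0[OF J] subspace_0[OF H_subspace] by auto
  qed
  ultimately have "J = {0}" by (rule no_ideal)
  then show ?thesis using xJ by auto
qed

section \<open>Serre relations and local nilpotency\<close>

lemma br_pow_add: "(br x ^^ n) (y + z) = (br x ^^ n) y + (br x ^^ n) z"
  by (induction n) (auto simp: br_add_r)

lemma br_pow_scale: "(br x ^^ n) (sc c y) = sc c ((br x ^^ n) y)"
  by (induction n) (auto simp: br_sc_r)

lemma br_pow_0 [simp]: "(br x ^^ n) 0 = 0"
  by (induction n) auto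

lemma br_pow_0_mono: "(br x ^^ m) y = 0 \<Longrightarrow> m \<le> n \<Longrightarrow> (br x ^^ n) y = 0"
  using funpow_add[of "n - m" m "br x"] by simp

text \<open>Leibniz distributes m + n applications of ad z over the two factors, and each term has
  at least m on \<open>x\<close> or at least n on \<open>y\<close>.\<close>

lemma br_pow_br_0:
  "(br z ^^ m) x = 0 \<Longrightarrow> (br z ^^ n) y = 0 \<Longrightarrow> (br z ^^ (m + n)) (br x y) = 0"
proof (induction "m + n" arbitrary: m n x y)
  case 0
  then show ?case by simp
next
  case (Suc s)
  show ?case
  proof (cases "m = 0 \<or> n = 0")
    case True
    then show ?thesis using Suc.prems by auto
  next
    case False
    then obtain m' n' where mn: "m = Suc m'" "n = Suc n'" by (meson not0_implies_Suc)
    have "(br z ^^ (m' + n)) (br (br z x) y) = 0"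
      using Suc.prems Suc.hyps(2) mn by (intro Suc.hyps(1)) (auto simp: funpow_swap1)
    moreover have "(br z ^^ (m + n')) (br x (br z y)) = 0"
      using Suc.prems Suc.hyps(2) mn by (intro Suc.hyps(1)) (auto simp: funpow_swap1)
    moreover have "(br z ^^ (m + n)) (br x y) = (br z ^^ (m' + n)) (br z (br x y))"
      using mn by (simp add: funpow_swap1)
    ultimately show ?thesis
      using mn by (simp add: br_leibniz[of z x y] br_pow_add br_add_r)
  qed
qed

lemma e_pow_G: "x \<in> G k \<Longrightarrow> (br (e i) ^^ n) x \<in> G (shift i (int n) k)"
proof (induction n)
  case (Suc n)
  then show ?case using G_br[OF e_G, of "(br (e i) ^^ n) x" "shift i (int n) k" i]
    by (simp add: add_unit_wt)
qed simp

section \<open>Computations with sl2 triples\<close>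

lemma sl2_weight:
  assumes "br (coroot i) v = sc \<mu> v"
  shows "br (coroot i) ((br (e i) ^^ n) v) = sc (\<mu> + 2 * of_nat n) ((br (e i) ^^ n) v)"
proof (induction n)
  case 0
  then show ?case using assms by simp
next
  case (Suc n)
  have "br (coroot i) (br (e i) ((br (e i) ^^ n) v)) =
      sc 2 (br (e i) ((br (e i) ^^ n) v)) + sc (\<mu> + 2 * of_nat n) (br (e i) ((br (e i) ^^ n) v))"
    by (simp add: br_leibniz[of "coroot i" "e i"] br_He[OF coroot_H] alpha_coroot A_diag br_sc_l Suc br_sc_r)
  also have "\<dots> = sc (\<mu> + 2 * of_nat (Suc n)) (br (e i) ((br (e i) ^^ n) v))"
    unfolding scale_left_distrib[symmetric]
    by (rule arg_cong[where f = "\<lambda>c. sc c _"]) simp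
  finally show ?case by simp
qed

text \<open>The coefficient is minus the sum of the coroot eigenvalues mu, mu + 2, ..., mu + 2n met
  when \<open>f i\<close> moves through the n + 1 factors \<open>e i\<close>.\<close>

lemma sl2_raise:
  assumes v: "br (coroot i) v = sc \<mu> v" and f: "br (f i) v = 0"
  shows "br (f i) ((br (e i) ^^ Suc n) v)
    = sc (- (of_nat (Suc n) * (\<mu> + of_nat n))) ((br (e i) ^^ n) v)"
proof (induction n)
  case 0
  then show ?case by (simp add: br_leibniz[of "f i" "e i"] br_fe f v br_minus_l)
next
  case (Suc n)
  let ?w = "(br (e i) ^^ Suc n) v"
  have "br (f i) (br (e i) ?w) = - br (coroot i) ?w + br (e i) (br (f i) ?w)"
    by (simp only: br_leibniz[of "f i" "e i"] br_fe refl if_True br_minus_l)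
  also have "\<dots> = sc (- (\<mu> + 2 * of_nat (Suc n))) ?w
      + sc (- (of_nat (Suc n) * (\<mu> + of_nat n))) ?w"
    unfolding Suc sl2_weight[OF v] by (simp only: br_sc_r br_minus_r scale_minus_left funpow.simps o_apply)
  also have "\<dots> = sc (- (of_nat (Suc (Suc n)) * (\<mu> + of_nat (Suc n)))) ?w"
    unfolding scale_left_distrib[symmetric] by (rule arg_cong[where f = "\<lambda>c. sc c ?w"]) (simp add: algebra_simps)
  finally show ?case by simp
qed

text \<open>\<open>pos k x y\<close>: the element \<open>x\<close> of \<open>\<nn>\<^sub>+\<close> has weight \<open>k\<close> and \<open>y\<close> is its image under the compact
  involution. \<open>cart\<close> is the analogue on the span of the coroots.\<close>
inductive pos :: "('i \<Rightarrow> int) \<Rightarrow> 'g \<Rightarrow> 'g \<Rightarrow> bool" where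
  pos_gen: "pos (unit_wt i) (e i) (- f i)"
| pos_add: "pos k x y \<Longrightarrow> pos k u v \<Longrightarrow> pos k (x + u) (y + v)"
| pos_scale: "pos k x y \<Longrightarrow> pos k (sc c x) (sc (cnj c) y)"
| pos_step: "pos k x y \<Longrightarrow> pos (k + unit_wt i) (br (e i) x) (br (- f i) y)"

lemma pos_pos: "pos k x y \<Longrightarrow> 0 < k"
  by (induction rule: pos.induct) (auto intro: unit_wt_pos add_unit_wt_pos)

lemma pos_G: "pos k x y \<Longrightarrow> x \<in> G k \<and> y \<in> G (- k)"
proof (induction rule: pos.induct)
  case (pos_gen i)
  then show ?case using e_G f_G subspace_neg[OF subspace_G] by blast
next
  case (pos_step k x y i)
  have "br (- f i) y \<in> G (- unit_wt i + - k)"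
    using pos_step f_G subspace_neg[OF subspace_G] by (intro G_br) auto
  moreover have "br (e i) x \<in> G (unit_wt i + k)"
    using pos_step e_G by (intro G_br) auto
  ultimately show ?case by (simp add: add.commute)
qed (auto intro: subspace_add[OF subspace_G] subspace_scale[OF subspace_G])

definition cart :: "'g \<Rightarrow> 'g \<Rightarrow> bool" where
  "cart x y \<longleftrightarrow> (\<exists>c. x = (\<Sum>i\<in>UNIV. sc (c i) (coroot i)) \<and> y = (\<Sum>i\<in>UNIV. sc (- cnj (c i)) (coroot i)))"

lemma cart_add: "cart x y \<Longrightarrow> cart u v \<Longrightarrow> cart (x + u) (y + v)"
proof -
  assume "cart x y" "cart u v"
  then obtain c d where "x = (\<Sum>i\<in>UNIV. sc (c i) (coroot i))" "y = (\<Sum>i\<in>UNIV. sc (- cnj (c i)) (coroot i))"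
    "u = (\<Sum>i\<in>UNIV. sc (d i) (coroot i))" "v = (\<Sum>i\<in>UNIV. sc (- cnj (d i)) (coroot i))"
    unfolding cart_def by blast
  then show ?thesis unfolding cart_def
    by (intro exI[of _ "\<lambda>i. c i + d i"])
      (simp add: sum.distrib[symmetric] scale_left_distrib[symmetric] del: scale_minus_left)
qed

lemma cart_scale: "cart x y \<Longrightarrow> cart (sc a x) (sc (cnj a) y)"
proof -
  assume "cart x y"
  then obtain c where "x = (\<Sum>i\<in>UNIV. sc (c i) (coroot i))" "y = (\<Sum>i\<in>UNIV. sc (- cnj (c i)) (coroot i))"
    unfolding cart_def by blast
  then show ?thesis unfolding cart_def
    by (intro exI[of _ "\<lambda>i. a * c i"]) (simp add: scale_sum_right)
qed

lemma cart_coroot: "cart (sc c (coroot i)) (sc (- cnj c) (coroot i))"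
proof -
  have *: "(\<Sum>j\<in>UNIV. sc (if j = i then d else 0) (coroot j)) = sc d (coroot i)" for d
  proof -
    have "(\<Sum>j\<in>UNIV. sc (if j = i then d else 0) (coroot j)) = (\<Sum>j\<in>UNIV. if j = i then sc d (coroot j) else 0)"
      by (rule sum.cong) auto
    then show ?thesis by simp
  qed
  show ?thesis unfolding cart_def
    using *[of c] *[of "- cnj c"]
    by (intro exI[of _ "\<lambda>j. if j = i then c else 0"]) (simp add: if_distrib cong: if_cong)
qed

lemma cart_0: "cart 0 y \<Longrightarrow> y = 0"
  unfolding cart_def using coroot_indep by fastforce

lemma cart_H: "cart x y \<Longrightarrow> x \<in> H \<and> y \<in> H"
  unfolding cart_def by (auto intro!: subspace_sum[OF H_subspace] subspace_scale[OF H_subspace] 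
      subspace_neg[OF H_subspace] coroot_H)

text \<open>Receives one step down from a positive weight. The zero pair is allowed at every weight
  because [f_i, e_j] with i distinct from j vanishes at a weight that is neither positive nor
  zero.\<close>

definition low :: "('i \<Rightarrow> int) \<Rightarrow> 'g \<Rightarrow> 'g \<Rightarrow> bool" where
  "low k x y \<longleftrightarrow> pos k x y \<or> (k = 0 \<and> cart x y) \<or> (x = 0 \<and> y = 0)"

lemma not_pos_0: "\<not> pos 0 x y"
  using pos_pos by blast

lemma low_add: "low k x y \<Longrightarrow> low k u v \<Longrightarrow> low k (x + u) (y + v)"
  unfolding low_def using not_pos_0 pos_add cart_add by auto

lemma low_scale: "low k x y \<Longrightarrow> low k (sc c x) (sc (cnj c) y)"
  unfolding low_def using pos_scale cart_scale by auto

lemma low_up: assumes "low k x y" shows "low (k + unit_wt i) (br (e i) x) (br (- f i) y)"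
proof -
  consider "pos k x y" | "k = 0" "cart x y" | "x = 0" "y = 0" using assms low_def by blast
  then show ?thesis
  proof cases
    case 1
    then show ?thesis using pos_step low_def by blast
  next
    case 2
    then obtain c where c: "x = (\<Sum>j\<in>UNIV. sc (c j) (coroot j))" "y = (\<Sum>j\<in>UNIV. sc (- cnj (c j)) (coroot j))"
      unfolding cart_def by blast
    define d where "d = - (\<Sum>j\<in>UNIV. c j * of_int (A j i))"
    have ce: "br (e i) (coroot j) = sc (- of_int (A j i)) (e i)" for j
      using br_anti[of "e i" "coroot j"] by (simp add: br_He[OF coroot_H] alpha_coroot)
    have cf: "br (f i) (coroot j) = sc (of_int (A j i)) (f i)" for j
      using br_anti[of "f i" "coroot j"] by (simp add: br_Hf[OF coroot_H] alpha_coroot)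
    have "br (e i) x = sc d (e i)"
      unfolding c d_def br_sum_r by (simp add: br_sc_r ce scale_sum_left sum_negf)
    moreover have "br (- f i) y = sc (cnj d) (- f i)"
      unfolding c d_def br_sum_r by (simp add: br_sc_r cf scale_sum_left sum_negf br_minus_l br_minus_r)
    ultimately show ?thesis using 2 pos_scale[OF pos_gen[of i], of d] by (simp add: low_def)
  next
    case 3
    then show ?thesis by (simp add: low_def)
  qed
qed

lemma wt_coroot: "wt k (coroot i) = of_int (\<Sum>j\<in>UNIV. k j * A i j)"
  by (simp add: wt_def alpha_coroot)

text \<open>Leibniz splits [f_i, [e_j, x]] into a term covered by the induction and [[f_i, e_j], x],
  which for i = j is a scalar multiple of \<open>x\<close>.\<close>

lemma pos_down: "pos k x y \<Longrightarrow> low (k - unit_wt i) (br (f i) x) (br (- e i) y)"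
proof (induction rule: pos.induct)
  case (pos_gen j)
  show ?case
  proof (cases "i = j")
    case True
    \<comment> \<open>The partner of [f_j, e_j] = - coroot_j is [- e_j, - f_j] = coroot_j; this
      explains the coefficient -1 and the sign in \<open>cart\<close>.\<close>
    then show ?thesis using cart_coroot[of "-1" j]
      by (simp add: low_def br_fe br_minus_l br_minus_r br_ef)
  next
    case False
    then show ?thesis by (simp add: low_def br_fe br_minus_l br_minus_r br_ef)
  qed
next
  case (pos_add k x y u v)
  then show ?case unfolding br_add_r using low_add by blast
next
  case (pos_scale k x y c)
  then show ?case unfolding br_sc_r using low_scale by blast
next
  case (pos_step k x y j)
  have "low (k - unit_wt i + unit_wt j) (br (e j) (br (f i) x)) (br (- f j) (br (- e i) y))"
    using low_up[OF pos_step.IH] .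
  then have 1: "low (k + unit_wt j - unit_wt i) (br (e j) (br (f i) x)) (br (- f j) (br (- e i) y))"
    by (simp add: algebra_simps)
  have G: "x \<in> G k" "y \<in> G (- k)" using pos_G[OF pos_step.hyps] by auto
  have 2: "low (k + unit_wt j - unit_wt i) (br (br (f i) (e j)) x) (br (br (- e i) (- f j)) y)"
  proof (cases "i = j")
    case True
    \<comment> \<open>Weights take integer values on coroots, so the scalar equals its conjugate, as
      the antilinear partner requires.\<close>
    have real: "cnj (wt k (coroot l)) = wt k (coroot l)" for l by (simp add: wt_coroot)
    have "br (br (f i) (e j)) x = sc (- wt k (coroot i)) x"
      using True br_H_G[OF G(1) coroot_H] by (simp add: br_fe br_minus_l)
    moreover have "br (br (- e i) (- f j)) y = sc (cnj (- wt k (coroot i))) y"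
      using True br_H_G[OF G(2) coroot_H] by (simp add: br_ef br_minus_l br_minus_r wt_minus real)
    ultimately show ?thesis
      using True pos_scale[OF pos_step.hyps, of "- wt k (coroot i)"] by (simp add: low_def)
  next
    case False
    then show ?thesis by (simp add: low_def br_fe br_minus_l br_minus_r br_ef)
  qed
  show ?case
    unfolding br_leibniz[of "f i" "e j" x] br_leibniz[of "- e i" "- f j" y]
    using low_add[OF 2 1] .
qed

text \<open>Only \<open>e i\<close> can have been used when the weight is supported at
  \<open>i\<close>, and [e_i, e_i] = 0. So the alpha_i space is the line through \<open>e i\<close>,
  and larger multiples of alpha_i carry only zero.\<close>

lemma pos_multiple_unit:
  "pos k x y \<Longrightarrow> (\<And>j. j \<noteq> i \<Longrightarrow> k j = 0) \<Longrightarrow>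
    \<exists>c. x = sc c (e i) \<and> y = sc (cnj c) (- f i) \<and> (k \<noteq> unit_wt i \<longrightarrow> c = 0)"
proof (induction rule: pos.induct)
  case (pos_gen j)
  then have "j = i" by (force simp: unit_wt_def)
  then show ?case by (intro exI[of _ 1]) auto
next
  case (pos_add k x y u v)
  then obtain c d where "x = sc c (e i) \<and> y = sc (cnj c) (- f i) \<and> (k \<noteq> unit_wt i \<longrightarrow> c = 0)"
    "u = sc d (e i) \<and> v = sc (cnj d) (- f i) \<and> (k \<noteq> unit_wt i \<longrightarrow> d = 0)" by blast
  then show ?case by (intro exI[of _ "c + d"]) (auto simp: scale_left_distrib)
next
  case (pos_scale k x y c)
  then obtain d where "x = sc d (e i) \<and> y = sc (cnj d) (- f i) \<and> (k \<noteq> unit_wt i \<longrightarrow> d = 0)" by blast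
  then show ?case by (intro exI[of _ "c * d"]) auto
next
  case (pos_step k x y j)
  have k: "0 \<le> k l" for l using pos_pos[OF pos_step.hyps] unfolding pos_wt_iff by auto
  have ij: "j = i"
  proof (rule ccontr)
    assume "j \<noteq> i"
    then have "k j + 1 = 0" using pos_step.prems[of j] by (simp add: unit_wt_def wt_apply)
    then show False using k[of j] by simp
  qed
  then have "k l = 0" if "l \<noteq> i" for l using pos_step.prems[OF that] that by (simp add: unit_wt_def wt_apply)
  then obtain c where "x = sc c (e i)" "y = sc (cnj c) (- f i)" using pos_step.IH by blast
  then show ?case using ij by (intro exI[of _ 0]) (simp add: br_sc_r br_minus_l br_minus_r)
qed

text \<open>\<open>words n\<close> consists of iterated brackets of n + 1 generators, so height h
  uses \<open>words (h - 1)\<close>. Being finite, these sets bound the dimensions of the positive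
  root spaces.\<close>

primrec words :: "nat \<Rightarrow> 'g set" where
  "words 0 = range e"
| "words (Suc n) = (\<Union>i. br (e i) ` words n)"

lemma finite_words: "finite (words n)"
  by (induction n) auto

lemma pos_span_words: "pos k x y \<Longrightarrow> x \<in> span (words (nat (ht k) - 1))"
proof (induction rule: pos.induct)
  case (pos_gen i)
  then show ?case by (auto intro: span_base)
next
  case (pos_step k x y i)
  have *: "nat (ht (k + unit_wt i)) - 1 = Suc (nat (ht k) - 1)"
    using ht_pos[OF pos_pos[OF pos_step.hyps]] by (simp add: ht_add)
  have "br (e i) z \<in> span (words (Suc n))" if "z \<in> span (words n)" for z n
    using that
  proof (induction rule: span_induct)
    case base
    show ?case using subspace_span[of "words (Suc n)"] by (auto simp: subspace_def br_add_r br_sc_r)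
  next
    case (step z)
    then show ?case by (intro span_base) auto
  qed
  then show ?case unfolding * using pos_step.IH .
next
  case (pos_add k x y u v)
  then show ?case by (intro span_add)
next
  case (pos_scale k x y c)
  then show ?case by (intro span_scale)
qed

lemma f_e_pow_comm:
  assumes "k \<noteq> i" shows "br (f k) ((br (e i) ^^ n) v) = (br (e i) ^^ n) (br (f k) v)"
proof (induction n)
  case (Suc n)
  then show ?case using assms by (simp add: br_leibniz[of "f k" "e i"] br_fe)
qed simp

text \<open>The vector is killed by every \<open>f k\<close> and has positive height, so
  \<open>annihilated_zero\<close> applies. For k = i the coefficient in \<open>sl2_raise\<close>
  contains the factor A i j + n = 0.\<close>

lemma serre:
  assumes "i \<noteq> j" shows "(br (e i) ^^ nat (1 - A i j)) (e j) = 0"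
proof -
  define n where "n = nat (- A i j)"
  have n: "nat (1 - A i j) = Suc n" "A i j = - int n"
    using A_offdiag[OF assms] by (auto simp: n_def)
  let ?t = "(br (e i) ^^ Suc n) (e j)"
  have "br (f k) ?t = 0" for k
  proof -
    consider "k = i" | "k = j" "k \<noteq> i" | "k \<noteq> j" "k \<noteq> i" by blast
    then show ?thesis
    proof cases
      case 1
      have "br (coroot i) (e j) = sc (of_int (A i j)) (e j)"
        by (simp add: br_He[OF coroot_H] alpha_coroot)
      then show ?thesis using sl2_raise[of i "e j" "of_int (A i j)" n] 1 assms n by (simp add: br_fe)
    next
      case 2
      have c: "br (e i) (coroot j) = sc (- of_int (A j i)) (e i)"
        using br_anti[of "e i" "coroot j"] by (simp add: br_He[OF coroot_H] alpha_coroot)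
      have "br (f k) ?t = (br (e i) ^^ Suc n) (br (f k) (e j))"
        by (rule f_e_pow_comm[OF 2(2)])
      also have "\<dots> = (br (e i) ^^ n) (br (e i) (- coroot j))"
        by (simp only: 2(1) br_fe refl if_True funpow_Suc_right o_apply)
      also have "\<dots> = sc (of_int (A j i)) ((br (e i) ^^ n) (e i))"
        by (simp add: br_minus_r c br_pow_scale)
      also have "\<dots> = 0"
      \<comment> \<open>For n = 0 the scalar \<open>A j i\<close> vanishes together with
        \<open>A i j\<close>; for larger n a bracket of \<open>e i\<close> with itself
        occurs.\<close>
      proof (cases n)
        case 0
        then show ?thesis using n(2) A_zero[of i j] by simp
      next
        case (Suc m)
        then show ?thesis by (simp only: funpow_Suc_right o_apply br_self br_pow_0 scale_zero_right)
      qed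
      finally show ?thesis .
    next
      case 3
      have "br (f k) ?t = (br (e i) ^^ Suc n) (br (f k) (e j))"
        by (rule f_e_pow_comm[OF 3(2)])
      then show ?thesis using 3(1) by (simp add: br_fe)
    qed
  qed
  note f0 = this
  have "?t \<in> G (shift i (int (Suc n)) (unit_wt j))" by (rule e_pow_G[OF e_G])
  moreover have "0 < ht (shift i (int (Suc n)) (unit_wt j))" by simp
  ultimately have "?t = 0" using annihilated_zero f0 by metis
  then show ?thesis using n by simp
qed

text \<open>The Serre relations settle the generators, and \<open>br_pow_br_0\<close> carries
  nilpotency through brackets. Strings in direction alpha_i therefore stop, as the reflection
  argument requires.\<close>

lemma pos_nilpotent: "pos k x y \<Longrightarrow> \<exists>n. (br (e i) ^^ n) x = 0"
proof (induction rule: pos.induct)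
  case (pos_gen j)
  then show ?case using serre[of i j] by (cases "i = j") (auto intro: exI[of _ 1])
next
  case (pos_add k x y u v)
  then obtain m n where "(br (e i) ^^ m) x = 0" "(br (e i) ^^ n) u = 0" by blast
  then show ?case using br_pow_0_mono[of m "e i" x "m + n"] br_pow_0_mono[of n "e i" u "m + n"]
    by (intro exI[of _ "m + n"]) (simp add: br_pow_add)
next
  case (pos_scale k x y c)
  then show ?case by (auto simp: br_pow_scale)
next
  case (pos_step k x y j)
  obtain m where "(br (e i) ^^ m) (e j) = 0"
    using serre[of i j] by (cases "i = j") (auto intro: that[of 1] that)
  moreover obtain n where "(br (e i) ^^ n) x = 0" using pos_step.IH by blast
  ultimately show ?case using br_pow_br_0 by (intro exI[of _ "m + n"])
qed

section \<open>The compact involution\<close>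

text \<open>Since [f_i, e_i] = - coroot_i, exchanging \<open>e\<close> and \<open>f\<close> puts a
  sign on coroots and roots, and the two signs cancel in the matrix \<open>A\<close>.\<close>

lemma swap: "kac_moody_algebra sc A br H (\<lambda>i h. - alpha i h) (\<lambda>i. - coroot i) f e"
proof (unfold_locales, goal_cases)
  case 6 then show ?case by (rule jacobi)
next
  case 10 then show ?case using alpha_indep by (simp add: sum_negf)
next
  case 12 then show ?case using coroot_indep by (simp add: sum_negf)
next
  case 14 then show ?case by (auto simp: br_fe)
next
  case 18 then show ?case using generated by blast
next
  case 19 then show ?case using no_ideal by blast
qed (auto simp: br_add_l br_add_r br_sc_l br_sc_r H_subspace alpha_add alpha_sc coroot_H
    subspace_neg[OF H_subspace] br_HH br_He br_Hf A_diag A_offdiag A_zero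
    alpha_sc[of _ _ "-1", simplified] alpha_coroot)

interpretation neg: kac_moody_algebra sc A br H "\<lambda>i h. - alpha i h" "\<lambda>i. - coroot i" f e
  by (rule swap)

lemma neg_wt: "neg.wt k h = wt (- k) h"
  by (simp add: neg.wt_def wt_def wt_apply)

lemma neg_G: "neg.G k = G (- k)"
  by (auto simp: neg.G_iff G_iff neg_wt)

lemma neg_pos_imp_pos: "neg.pos k x y \<Longrightarrow> pos k y x"
proof (induction rule: neg.pos.induct)
  case (pos_gen i)
  then show ?case using pos_scale[OF pos.pos_gen[of i], of "-1"] by simp
next
  case (pos_scale k x y c)
  then show ?case using pos.pos_scale[of k y x "cnj c"] by simp
next
  case (pos_step k x y i)
  then show ?case using pos_scale[OF pos.pos_step[of k y x i], of "-1"] by (simp add: br_minus_l)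
qed (rule pos_add)

lemma neg_cart_iff: "neg.cart x y \<longleftrightarrow> cart x y"
proof
  assume "neg.cart x y"
  then obtain c where "x = (\<Sum>i\<in>UNIV. sc (c i) (- coroot i))" "y = (\<Sum>i\<in>UNIV. sc (- cnj (c i)) (- coroot i))"
    unfolding neg.cart_def by blast
  then show "cart x y" unfolding cart_def by (intro exI[of _ "\<lambda>i. - c i"]) simp
next
  assume "cart x y"
  then obtain c where "x = (\<Sum>i\<in>UNIV. sc (c i) (coroot i))" "y = (\<Sum>i\<in>UNIV. sc (- cnj (c i)) (coroot i))"
    unfolding cart_def by blast
  then show "neg.cart x y" unfolding neg.cart_def by (intro exI[of _ "\<lambda>i. - c i"]) simp
qed

text \<open>Stepping down from (0, y) gives pairs (0, [- e_i, y]), whose second entry is zero by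
  induction or by independence of the coroots. Hence every \<open>e i\<close> kills
  \<open>y\<close>, and the mirrored \<open>annihilated_zero\<close> applies.\<close>

lemma pos_0: "pos k 0 y \<Longrightarrow> y = 0"
proof (induction "nat (ht k)" arbitrary: k y rule: less_induct)
  case less
  have h: "0 < ht k" using less.prems pos_pos ht_pos by blast
  have "br (e i) y = 0" for i
  proof -
    have "low (k - unit_wt i) 0 (br (- e i) y)" using pos_down[OF less.prems, of i] by simp
    then consider "pos (k - unit_wt i) 0 (br (- e i) y)" | "cart 0 (br (- e i) y)" | "br (- e i) y = 0"
      unfolding low_def by blast
    then have "br (- e i) y = 0"
    proof cases
      case 1
      then show ?thesis using less.hyps[OF _ 1] h by (simp add: ht_diff)
    qed (auto simp: cart_0)
    then show ?thesis by (simp add: br_minus_l)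
  qed
  moreover have "y \<in> neg.G k" using pos_G[OF less.prems] by (simp add: neg_G)
  ultimately show ?case using neg.annihilated_zero[of y k] h by blast
qed

text \<open>The compact involution: antilinear, multiplicative, \<open>e\<^sub>i \<mapsto> - f\<^sub>i\<close> and \<open>f\<^sub>i \<mapsto> - e\<^sub>i\<close>. Since nothing
  is presented by generators and relations here, it is first generated as a graded relation and
  only then shown to be single-valued.\<close>
inductive dual :: "('i \<Rightarrow> int) \<Rightarrow> 'g \<Rightarrow> 'g \<Rightarrow> bool" where
  dual_e: "dual (unit_wt i) (e i) (- f i)"
| dual_f: "dual (- unit_wt i) (f i) (- e i)"
| dual_add: "dual k x y \<Longrightarrow> dual k u v \<Longrightarrow> dual k (x + u) (y + v)"
| dual_scale: "dual k x y \<Longrightarrow> dual k (sc c x) (sc (cnj c) y)"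
| dual_br: "dual k x y \<Longrightarrow> dual l u v \<Longrightarrow> dual (k + l) (br x u) (br y v)"

lemma dual_sym: "dual k x y \<Longrightarrow> dual (- k) y x"
proof (induction rule: dual.induct)
  case (dual_e i)
  then show ?case using dual_scale[OF dual_f[of i], of "-1"] by simp
next
  case (dual_f i)
  then show ?case using dual_scale[OF dual_e[of i], of "-1"] by simp
next
  case (dual_scale k x y c)
  then show ?case using dual.dual_scale[of "- k" y x "cnj c"] by simp
next
  case (dual_br k x y l u v)
  then show ?case using dual.dual_br[of "- k" y x "- l" v u] by simp
qed (rule dual.dual_add)

lemma dual_minus: "dual k x y \<Longrightarrow> dual k (- x) (- y)"
  using dual_scale[of k x y "-1"] by simp

lemma dual_G: "dual k x y \<Longrightarrow> x \<in> G k"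
proof (induction rule: dual.induct)
  case (dual_br k x y l u v)
  then show ?case by (intro G_br)
qed (auto intro: e_G f_G subspace_add[OF subspace_G] subspace_scale[OF subspace_G])

text \<open>A normal form along n_- + h + n_+. A \<open>dual\<close> pair may arise from arbitrary
  mixed brackets of \<open>e\<close> and \<open>f\<close>; \<open>dual_tri\<close> brings it to a
  shape in which single-valuedness is already known.\<close>

definition tri :: "('i \<Rightarrow> int) \<Rightarrow> 'g \<Rightarrow> 'g \<Rightarrow> bool" where
  "tri k x y \<longleftrightarrow> low k x y \<or> neg.low (- k) x y"

lemma tri_low: assumes "\<not> 0 < - k" shows "tri k x y \<longleftrightarrow> low k x y"
proof -
  have "\<not> neg.pos (- k) x y" using neg.pos_pos assms by blast
  then show ?thesis by (auto simp: tri_def low_def neg.low_def neg_cart_iff)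
qed

lemma tri_neg_low: assumes "0 < - k" shows "tri k x y \<longleftrightarrow> neg.low (- k) x y"
proof -
  have "\<not> pos k x y" using pos_pos pos_wt_asym assms by blast
  then show ?thesis by (auto simp: tri_def low_def neg.low_def neg_cart_iff)
qed

lemma tri_add: "tri k x y \<Longrightarrow> tri k u v \<Longrightarrow> tri k (x + u) (y + v)"
  by (cases "0 < - k") (auto simp: tri_low tri_neg_low intro: low_add neg.low_add)

lemma tri_scale: "tri k x y \<Longrightarrow> tri k (sc c x) (sc (cnj c) y)"
  by (cases "0 < - k") (auto simp: tri_low tri_neg_low intro: low_scale neg.low_scale)

lemma tri_e: assumes "tri k x y" shows "tri (unit_wt i + k) (br (e i) x) (br (- f i) y)"
proof -
  consider "low k x y" | "neg.pos (- k) x y"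
    using assms by (auto simp: tri_def low_def neg.low_def neg_cart_iff)
  then show ?thesis
  proof cases
    case 1
    then show ?thesis using low_up[OF 1, of i] by (simp add: tri_def add.commute)
  next
    case 2
    have "- k - unit_wt i = - (unit_wt i + k)" by simp
    then show ?thesis using neg.pos_down[OF 2, of i] by (metis tri_def)
  qed
qed

lemma tri_f: assumes "tri k x y" shows "tri (- unit_wt i + k) (br (f i) x) (br (- e i) y)"
proof -
  consider "pos k x y" | "neg.low (- k) x y"
    using assms by (auto simp: tri_def low_def neg.low_def neg_cart_iff)
  then show ?thesis
  proof cases
    case 1
    then show ?thesis using pos_down[OF 1, of i] by (simp add: tri_def)
  next
    case 2
    then show ?thesis using neg.low_up[OF 2, of i] by (simp add: tri_def)
  qed
qed

text \<open>Writing ad [x, x'] as a commutator reduces the action of an arbitrary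
  \<open>dual\<close> pair to that of the generators, treated by \<open>tri_e\<close> and
  \<open>tri_f\<close>.\<close>

lemma tri_br: "dual k x y \<Longrightarrow> tri l u v \<Longrightarrow> tri (k + l) (br x u) (br y v)"
proof (induction arbitrary: l u v rule: dual.induct)
  case (dual_add k x y x' y')
  then show ?case unfolding br_add_l by (intro tri_add)
next
  case (dual_scale k x y c)
  then show ?case unfolding br_sc_l by (intro tri_scale)
next
  case (dual_br k x y k' x' y')
  have "tri (k + (k' + l)) (br x (br x' u)) (br y (br y' v))"
    using dual_br.IH dual_br.prems by blast
  moreover have "tri (k' + (k + l)) (br x' (br x u)) (br y' (br y v))"
    using dual_br.IH dual_br.prems by blast
  ultimately have "tri (k + k' + l) (br x (br x' u) + sc (-1) (br x' (br x u)))
      (br y (br y' v) + sc (cnj (-1)) (br y' (br y v)))"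
    by (intro tri_add tri_scale) (simp_all add: add_ac)
  then show ?case by (simp add: br_leibniz[of x x' u] br_leibniz[of y y' v])
qed (rule tri_e tri_f; assumption)+

lemma dual_tri: "dual k x y \<Longrightarrow> tri k x y"
proof (induction rule: dual.induct)
  case (dual_e i)
  then show ?case using pos_gen by (simp add: tri_def low_def)
next
  case (dual_f i)
  then show ?case using neg.pos_gen by (simp add: tri_def neg.low_def)
qed (auto intro: tri_add tri_scale tri_br)

lemma dual_0: assumes "dual k 0 y" shows "y = 0"
proof -
  have "tri k 0 y" using assms dual_tri by blast
  then consider "pos k 0 y" | "cart 0 y" | "neg.pos (- k) 0 y" | "y = 0"
    by (auto simp: tri_def low_def neg.low_def neg_cart_iff)
  then show ?thesis
  proof cases
    case 3
    then show ?thesis by (rule kac_moody_algebra.pos_0[OF swap])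
  qed (auto simp: pos_0 cart_0)
qed

lemma G_disjoint: assumes "x \<in> G k" "x \<in> G l" "x \<noteq> 0" shows "k = l"
proof (rule ccontr)
  assume "k \<noteq> l"
  then obtain h where "h \<in> H" "wt k h \<noteq> wt l h" using wt_distinct by blast
  then show False using assms br_H_G[of x k h] br_H_G[of x l h] by simp
qed

lemma dual_unique: assumes "dual k x y" "dual l x z" shows "y = z"
proof (cases "x = 0")
  case True
  then show ?thesis using assms dual_0 by blast
next
  case False
  then have "k = l" using G_disjoint dual_G assms by blast
  then have "dual k (x + - x) (y + - z)" using assms dual_add dual_minus by blast
  then have "dual k 0 (y - z)" by simp
  then have "y - z = 0" by (rule dual_0)
  then show ?thesis by simp
qed

text \<open>Meaningful only on homogeneous members of \<open>dual\<close> pairs. In weight zero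
  these fill just the span of the coroots, hence the condition of nonzero weight in the later
  rules.\<close>

definition om :: "'g \<Rightarrow> 'g" where
  "om x = (THE y. \<exists>k. dual k x y)"

lemma om_eq: "dual k x y \<Longrightarrow> om x = y"
  unfolding om_def using dual_unique by blast

section \<open>The root space decomposition\<close>

text \<open>Candidate for the full weight space; since \<open>dual\<close> reaches only the coroot
  span in weight zero, \<open>H\<close> is put in there by hand.\<close>

definition W :: "('i \<Rightarrow> int) \<Rightarrow> 'g set" where
  "W k = (if k = 0 then H else {x. x = 0 \<or> (\<exists>y. dual k x y)})"

lemma subspace_W: "subspace (W k)"
proof (cases "k = 0")
  case True
  then show ?thesis by (simp add: W_def H_subspace)
next
  case False
  have "x + y \<in> W k" if "x \<in> W k" "y \<in> W k" for x y
    using that False dual_add unfolding W_def by fastforce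
  moreover have "sc c x \<in> W k" if "x \<in> W k" for c x
    using that False dual_scale unfolding W_def by fastforce
  ultimately show ?thesis using False by (auto simp: subspace_def W_def)
qed

lemma dual_W: assumes "dual k x y" shows "x \<in> W k"
proof (cases "k = 0")
  case True
  have "tri k x y" using assms by (rule dual_tri)
  then have "x = 0 \<or> cart x y"
    using True not_pos_0 neg.not_pos_0 by (auto simp: tri_def low_def neg.low_def neg_cart_iff)
  then show ?thesis using True cart_H subspace_0[OF H_subspace] by (auto simp: W_def)
next
  case False
  then show ?thesis using assms by (auto simp: W_def)
qed

lemma W_G: "W k \<subseteq> G k"
  using dual_G H_G subspace_0[OF subspace_G] unfolding W_def by auto

lemma W_br_H: assumes "h \<in> H" "x \<in> W k" shows "br h x \<in> W k"
proof -
  have "br h x = sc (wt k h) x" using br_H_G assms W_G by blast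
  then show ?thesis using subspace_scale[OF subspace_W] assms by simp
qed

lemma W_br: assumes "x \<in> W k" "y \<in> W l" shows "br x y \<in> W (k + l)"
proof -
  consider "k = 0" | "l = 0" | "x = 0 \<or> y = 0" | x' y' where "dual k x x'" "dual l y y'"
    using assms unfolding W_def by (auto split: if_splits)
  then show ?thesis
  proof cases
    case 1
    then show ?thesis using assms W_br_H[of x y l] by (simp add: W_def)
  next
    case 2
    then have "br y x \<in> W k" using assms W_br_H[of y x k] by (simp add: W_def)
    then show ?thesis using 2 br_anti[of x y] subspace_neg[OF subspace_W] by simp
  next
    case 3
    then show ?thesis using subspace_0[OF subspace_W] by auto
  next
    case 4
    then show ?thesis using dual_W[OF dual_br] by blast
  qed
qed

lemma span_W: "span (\<Union>k. W k) = UNIV" (is "span ?U = _")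
proof (rule generated)
  have U: "br x y \<in> ?U" if xy: "x \<in> ?U" "y \<in> ?U" for x y
  proof -
    obtain k l where "x \<in> W k" "y \<in> W l" using xy by blast
    then have "br x y \<in> W (k + l)" by (rule W_br)
    then show ?thesis by blast
  qed
  have 1: "br x y \<in> span ?U" if "x \<in> ?U" "y \<in> span ?U" for x y
    using that(2)
  proof (induction rule: span_induct)
    case base
    show ?case using subspace_span[of ?U] by (auto simp: subspace_def br_add_r br_sc_r)
  next
    case (step y)
    then show ?case using U[OF that(1)] by (intro span_base)
  qed
  have "br x y \<in> span ?U" if "x \<in> span ?U" "y \<in> span ?U" for x y
    using that(1)
  proof (induction rule: span_induct)
    case base
    show ?case using subspace_span[of ?U] by (auto simp: subspace_def br_add_l br_sc_l)
  next
    case (step x)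
    then show ?case using 1 that(2) by blast
  qed
  then show "lie_subalgebra sc br (span ?U)"
    by (simp add: lie_subalgebra_def)
  have "H \<subseteq> W 0" by (simp add: W_def)
  then show "H \<subseteq> span ?U" by (blast intro: span_base)
  show "range e \<subseteq> span ?U" using dual_W[OF dual_e] by (blast intro: span_base)
  show "range f \<subseteq> span ?U" using dual_W[OF dual_f] by (blast intro: span_base)
qed

text \<open>If the functional differed on \<open>H\<close> from every weight occurring in the
  expansion of \<open>x\<close>, that expansion would be a relation among vectors of distinct
  weights. Below, the index \<open>None\<close> carries the functional and \<open>Some k\<close> the
  lattice weights.\<close>

lemma root_space_W:
  assumes x: "x \<in> root_space sc br H a" "x \<noteq> 0"
  obtains k where "\<And>h. h \<in> H \<Longrightarrow> a h = wt k h" "x \<in> W k"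
proof -
  obtain K X where X: "finite K" "\<And>k. k \<in> K \<Longrightarrow> X k \<in> W k" "x = sum X K"
    using span_graded[of UNIV W x] subspace_W span_W by (metis UNIV_I)
  have "\<exists>k\<in>K. \<forall>h\<in>H. a h = wt k h"
  proof (rule ccontr)
    assume no: "\<not> ?thesis"
    define w where "w j = (case j of None \<Rightarrow> a | Some k \<Rightarrow> wt k)" for j
    define Y where "Y j = (case j of None \<Rightarrow> - x | Some k \<Rightarrow> X k)" for j
    have "Y j \<in> root_space sc br H (w j)" if "j \<in> insert None (Some ` K)" for j
      using that x(1) X(2)[THEN subsetD[OF W_G]] subspace_neg[OF subspace_root_space]
      by (auto simp: Y_def w_def G_def)
    moreover have "\<exists>h\<in>H. w i h \<noteq> w j h"
      if "i \<in> insert None (Some ` K)" "j \<in> insert None (Some ` K)" "i \<noteq> j" for i j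
    proof (cases i)
      case None
      then show ?thesis using that no by (auto simp: w_def)
    next
      case (Some k)
      show ?thesis
      proof (cases j)
        case None
        then show ?thesis using that no Some by (auto simp: w_def) metis
      next
        case (Some l)
        then show ?thesis using \<open>i = Some k\<close> wt_distinct[of k l] that by (auto simp: w_def)
      qed
    qed
    moreover have "sum Y (insert None (Some ` K)) = 0"
      using X(1,3) by (simp add: sum.reindex Y_def image_iff)
    ultimately have "Y None = 0"
      using indep_weights[of "insert None (Some ` K)" Y w None] X(1) by blast
    then show False using x by (simp add: Y_def)
  qed
  then obtain k where k: "k \<in> K" "\<And>h. h \<in> H \<Longrightarrow> a h = wt k h" by blast
  have xk: "x \<in> G k" using x k by (simp add: G_iff root_space_iff)
  \<comment> \<open>With \<open>x\<close> subtracted from its component at \<open>k\<close>, the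
    homogeneous terms sum to zero, so that component equals \<open>x\<close>.\<close>
  define Y where "Y l = (if l = k then X k - x else X l)" for l
  have "sum Y K = Y k + sum Y (K - {k})" using X(1) k(1) by (rule sum.remove)
  also have "sum Y (K - {k}) = sum X (K - {k})" by (rule sum.cong) (auto simp: Y_def)
  also have "\<dots> = x - X k" using X(1,3) k(1) by (simp add: sum_diff1)
  finally have "sum Y K = 0" by (simp add: Y_def)
  moreover have "Y l \<in> G l" if "l \<in> K" for l
    using that X(2)[THEN subsetD[OF W_G]] xk subspace_diff[OF subspace_G] by (auto simp: Y_def)
  ultimately have "Y k = 0" using G_indep[of K Y k] X(1) k(1) by blast
  then have "x = X k" by (simp add: Y_def)
  then show ?thesis using that[of k] k X(2) by blast
qed

lemma G_eq_W: "G k = W k"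
proof
  show "G k \<subseteq> W k"
  proof
    fix x assume x: "x \<in> G k"
    show "x \<in> W k"
    proof (cases "x = 0")
      case True
      then show ?thesis using subspace_0[OF subspace_W] by simp
    next
      case False
      obtain l where l: "\<And>h. h \<in> H \<Longrightarrow> wt k h = wt l h" "x \<in> W l"
        using root_space_W[of x "wt k"] x False by (auto simp: G_def)
      then have "k = l" using wt_distinct by blast
      then show ?thesis using l by simp
    qed
  qed
qed (rule W_G)

lemma G_0: "G 0 = H"
  by (simp add: G_eq_W W_def)

lemma dual_om: assumes "x \<in> G k" "x \<noteq> 0" "k \<noteq> 0" shows "dual k x (om x)"
proof -
  obtain y where "dual k x y" using assms by (auto simp: G_eq_W W_def)
  then show ?thesis using om_eq by simp
qed

lemma G_pos_or_neg:
  assumes "x \<in> G k" "x \<noteq> 0" "k \<noteq> 0"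
  shows "pos k x (om x) \<or> pos (- k) (om x) x"
proof -
  have d: "dual k x (om x)" using assms by (rule dual_om)
  have "tri k x (om x)" using d by (rule dual_tri)
  then have "pos k x (om x) \<or> neg.pos (- k) x (om x)"
    using assms by (auto simp: tri_def low_def neg.low_def)
  then show ?thesis using neg_pos_imp_pos by blast
qed

lemma G_pos: assumes "x \<in> G k" "x \<noteq> 0" "0 < k" shows "pos k x (om x)"
proof -
  have "\<not> pos (- k) (om x) x" using pos_pos pos_wt_asym assms(3) by blast
  then show ?thesis using G_pos_or_neg[OF assms(1,2)] assms(3) by blast
qed

lemma G_sign: assumes "x \<in> G k" "x \<noteq> 0" "k \<noteq> 0" shows "0 < k \<or> 0 < - k"
  using G_pos_or_neg[OF assms] pos_pos by blast

section \<open>Reflection of roots\<close>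

lemma f_pow_G: assumes "x \<in> G k" shows "(br (f i) ^^ n) x \<in> G (shift i (- int n) k)"
proof -
  have "- shift i (int n) (- k) = shift i (- int n) k"
    by (auto simp: shift_def wt_apply)
  then show ?thesis using neg.e_pow_G[of x "- k" n i] assms by (simp add: neg_G)
qed

lemma sl2_lower:
  assumes "br (coroot i) v = sc \<mu> v" "br (e i) v = 0"
  shows "br (e i) ((br (f i) ^^ Suc n) v) = sc (of_nat (Suc n) * (\<mu> - of_nat n)) ((br (f i) ^^ n) v)"
proof -
  have "br (- coroot i) v = sc (- \<mu>) v" using assms(1) by (simp add: br_minus_l)
  from neg.sl2_raise[OF this assms(2), of n] show ?thesis
    by (simp add: mult_minus_right[symmetric] del: mult_minus_right)
qed

text \<open>The scalar is the product of (j + 1)(h - j) over j < n, and no factor vanishes while n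
  is at most h.\<close>

lemma sl2_highest:
  assumes v: "br (coroot i) v = sc (of_nat h) v" "br (e i) v = 0" "v \<noteq> 0" and n: "n \<le> h"
  shows "\<exists>c. c \<noteq> 0 \<and> (br (e i) ^^ n) ((br (f i) ^^ n) v) = sc c v"
  using n
proof (induction n)
  case 0
  then show ?case by (intro exI[of _ 1]) auto
next
  case (Suc n)
  then obtain c where c: "c \<noteq> 0" "(br (e i) ^^ n) ((br (f i) ^^ n) v) = sc c v" by auto
  define d :: complex where "d = of_nat (Suc n) * (of_nat h - of_nat n)"
  have "d \<noteq> 0" using Suc.prems unfolding d_def mult_eq_0_iff right_minus_eq of_nat_eq_iff of_nat_eq_0_iff
    by simp
  moreover have "(br (e i) ^^ Suc n) ((br (f i) ^^ Suc n) v) = sc (d * c) v"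
    unfolding funpow_Suc_right[of n "br (e i)"] o_apply sl2_lower[OF v(1,2)] br_pow_scale c(2) d_def
    by simp
  ultimately show ?case using c(1) by (intro exI[of _ "d * c"]) auto
qed

text \<open>The reflected weight is again a root. Choosing \<open>x\<close> with the shortest string upwards makes it a
  multiple of \<open>f\<^sub>i\<^sup>q v\<close> for a highest weight vector \<open>v\<close>.\<close>
lemma reflected_root:
  assumes x: "x \<in> G k" "x \<noteq> 0" and k: "0 < k" and m: "wt k (coroot i) = of_nat m"
  shows "\<exists>y. y \<in> G (shift i (- int m) k) \<and> y \<noteq> 0"
proof -
  define Q where "Q q \<longleftrightarrow> (\<exists>x\<in>G k. x \<noteq> 0 \<and> (br (e i) ^^ Suc q) x = 0)" for q
  obtain n where "(br (e i) ^^ n) x = 0"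
    using pos_nilpotent[OF G_pos[OF x k]] by blast
  then have "Q n" using x br_pow_0_mono[of n "e i" x "Suc n"] unfolding Q_def by auto
  then obtain q where q: "Q q" "\<And>p. p < q \<Longrightarrow> \<not> Q p"
    using exists_least_iff[of Q] by blast
  have least: "y = 0" if y: "y \<in> G k" "(br (e i) ^^ q) y = 0" for y
  proof (cases q)
    case 0
    then show ?thesis using y by simp
  next
    case (Suc p)
    then show ?thesis using q(2)[of p] y unfolding Q_def by auto
  qed
  obtain y where y: "y \<in> G k" "y \<noteq> 0" "(br (e i) ^^ Suc q) y = 0"
    using q(1) unfolding Q_def by blast
  define v where "v = (br (e i) ^^ q) y"
  have v0: "v \<noteq> 0" using least y unfolding v_def by blast
  have ev: "br (e i) v = 0" using y(3) by (simp add: v_def)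
  \<comment> \<open>Raising q times adds 2q to the coroot eigenvalue m, so \<open>v\<close> survives
    m + 2q lowerings.\<close>
  have cv: "br (coroot i) v = sc (of_nat (m + 2 * q)) v"
    using sl2_weight[of i y "of_nat m" q] br_H_G[OF y(1) coroot_H] m by (simp add: v_def)
  have nz: "(br (f i) ^^ n) v \<noteq> 0" if "n \<le> m + 2 * q" for n
    using sl2_highest[OF cv ev v0 that] v0 by auto
  obtain c where c: "c \<noteq> 0" "(br (e i) ^^ q) ((br (f i) ^^ q) v) = sc c v"
    using sl2_highest[OF cv ev v0, of q] by auto
  have "(br (f i) ^^ q) v \<in> G k"
    using f_pow_G[OF e_pow_G[OF y(1), of q i], of q i] by (simp add: v_def)
  \<comment> \<open>Both vectors have the same image under q raisings, so minimality of q forces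
    them to agree.\<close>
  then have "sc c y - (br (f i) ^^ q) v \<in> G k"
    using y(1) subspace_diff[OF subspace_G] subspace_scale[OF subspace_G] by blast
  moreover have "(br (e i) ^^ q) (sc c y + sc (-1) ((br (f i) ^^ q) v)) = 0"
    unfolding br_pow_add br_pow_scale c(2) v_def[symmetric] by simp
  ultimately have "sc c y = (br (f i) ^^ q) v" using least by force
  \<comment> \<open>Lowering \<open>y\<close> by m steps amounts to lowering \<open>v\<close> by m +
    q steps, which is within the m + 2q available.\<close>
  then have "sc c ((br (f i) ^^ m) y) = (br (f i) ^^ (m + q)) v"
    by (simp add: funpow_add flip: br_pow_scale)
  then have "(br (f i) ^^ m) y \<noteq> 0" using nz[of "m + q"] by auto
  then show ?thesis using f_pow_G[OF y(1)] by blast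
qed

end

section \<open>The invariant form\<close>

locale kac_moody_form = kac_moody_algebra sc A br H alpha coroot e f
  for sc :: "complex \<Rightarrow> 'g::ab_group_add \<Rightarrow> 'g" and A :: "'i::finite \<Rightarrow> 'i \<Rightarrow> int"
    and br H alpha coroot e f +
  fixes Bf :: "'g \<Rightarrow> 'g \<Rightarrow> complex" and eps :: "'i \<Rightarrow> real"
  assumes Bf_add_l: "Bf (x + y) z = Bf x z + Bf y z"
    and Bf_sc_l: "Bf (sc c x) y = c * Bf x y"
    and Bf_sym: "Bf x y = Bf y x"
    and Bf_inv: "Bf (br x y) z = Bf x (br y z)"
    and Bf_nondeg_H: "x \<in> H \<Longrightarrow> (\<And>y. y \<in> H \<Longrightarrow> Bf x y = 0) \<Longrightarrow> x = 0"
    and eps_pos: "0 < eps i"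
    and Bf_coroot: "h \<in> H \<Longrightarrow> Bf (coroot i) h = of_real (eps i) * alpha i h"
begin

lemma Bf_add_r: "Bf x (y + z) = Bf x y + Bf x z"
  using Bf_add_l Bf_sym by metis

lemma Bf_sc_r: "Bf x (sc c y) = c * Bf x y"
  using Bf_sc_l Bf_sym by metis

lemma Bf_0_l [simp]: "Bf 0 x = 0"
  using Bf_sc_l[of 0 0 x] by simp

lemma Bf_0_r [simp]: "Bf x 0 = 0"
  using Bf_sc_r[of x 0 0] by simp

lemma Bf_minus_l: "Bf (- x) y = - Bf x y"
  using Bf_sc_l[of "-1" x y] by simp

lemma Bf_minus_r: "Bf x (- y) = - Bf x y"
  using Bf_sc_r[of x "-1" y] by simp

lemma Bf_diff_l: "Bf (x - y) z = Bf x z - Bf y z"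
  using Bf_add_l[of x "- y" z] by (simp add: Bf_minus_l)

lemma Bf_diff_r: "Bf z (x - y) = Bf z x - Bf z y"
  using Bf_add_r[of z x "- y"] by (simp add: Bf_minus_r)

lemma Bf_sum_l: "Bf (sum g S) x = (\<Sum>s\<in>S. Bf (g s) x)"
  by (induction S rule: infinite_finite_induct) (auto simp: Bf_add_l)

lemma Bf_sum_r: "Bf x (sum g S) = (\<Sum>s\<in>S. Bf x (g s))"
  by (induction S rule: infinite_finite_induct) (auto simp: Bf_add_r)

lemma eps_nz [simp]: "eps i \<noteq> 0"
  using eps_pos[of i] by simp

text \<open>\<open>tv k\<close> is \<open>\<nu>\<^sup>-\<^sup>1(k)\<close> and \<open>ip k l\<close> is \<open>(k|l)\<close>, for \<open>k\<close> and \<open>l\<close> in the root lattice.\<close>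
definition tv :: "('i \<Rightarrow> int) \<Rightarrow> 'g" where
  "tv k = (\<Sum>i\<in>UNIV. sc (of_int (k i) / of_real (eps i)) (coroot i))"

definition ip :: "('i \<Rightarrow> int) \<Rightarrow> ('i \<Rightarrow> int) \<Rightarrow> real" where
  "ip k l = (\<Sum>i\<in>UNIV. (\<Sum>j\<in>UNIV. of_int (l j * A i j)) / eps i * of_int (k i))"

lemma tv_H: "tv k \<in> H"
  unfolding tv_def by (intro subspace_sum[OF H_subspace] subspace_scale[OF H_subspace] coroot_H)

lemma Bf_tv: "h \<in> H \<Longrightarrow> Bf (tv k) h = wt k h"
  unfolding tv_def wt_def Bf_sum_l by (simp add: Bf_sc_l Bf_coroot)

lemma Bf_tv_tv: "Bf (tv k) (tv l) = of_real (ip l k)"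
proof -
  have *: "Bf (tv k) (coroot i) = of_int (\<Sum>j\<in>UNIV. k j * A i j)" for i
    using Bf_tv[OF coroot_H] by (simp add: wt_coroot)
  have "Bf (tv k) (tv l) = (\<Sum>i\<in>UNIV. of_int (l i) / of_real (eps i) * of_int (\<Sum>j\<in>UNIV. k j * A i j))"
    unfolding tv_def[of l] Bf_sum_r Bf_sc_r * ..
  also have "\<dots> = of_real (ip l k)"
    unfolding ip_def of_real_sum by (rule sum.cong) (auto simp: algebra_simps)
  finally show ?thesis .
qed

lemma wt_tv: "wt k (tv l) = of_real (ip l k)"
  using Bf_tv[OF tv_H] Bf_tv_tv by metis

lemma ip_sym: "ip k l = ip l k"
proof -
  have "complex_of_real (ip k l) = of_real (ip l k)"
    using Bf_tv_tv[of k l] Bf_tv_tv[of l k] Bf_sym by metis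
  then show ?thesis by simp
qed

lemma ip_unit: "ip (unit_wt i) k = (\<Sum>j\<in>UNIV. of_int (k j * A i j)) / eps i"
proof -
  have "ip (unit_wt i) k = (\<Sum>l\<in>UNIV. if l = i then (\<Sum>j\<in>UNIV. of_int (k j * A l j)) / eps l else 0)"
    unfolding ip_def by (rule sum.cong) (auto simp: unit_wt_def)
  then show ?thesis by simp
qed

lemma ip_expand: "ip k l = (\<Sum>i\<in>UNIV. ip (unit_wt i) l * of_int (k i))"
  unfolding ip_unit ip_def[of k] ..

lemma ip_shift_l: "ip (shift i n k) l = ip k l + of_int n * ip (unit_wt i) l"
  unfolding ip_expand[of "shift i n k"] ip_expand[of k] sum_shift by simp

lemma ip_shift_r: "ip l (shift i n k) = ip l k + of_int n * ip (unit_wt i) l"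
  using ip_shift_l[of i n k l] ip_sym by metis

lemma ip_add_l: "ip (k + l) m = ip k m + ip l m"
  unfolding ip_expand[of "k + l"] ip_expand[of k] ip_expand[of l]
  by (simp add: wt_apply distrib_left sum.distrib)

lemma ip_minus_l: "ip (- k) m = - ip k m"
  unfolding ip_expand[of "- k"] ip_expand[of k] by (simp add: wt_apply sum_negf)

lemma ip_diff_l: "ip (k - l) m = ip k m - ip l m"
  using ip_add_l[of k "- l" m] by (simp add: ip_minus_l)

lemma ip_diff_r: "ip m (k - l) = ip m k - ip m l"
  using ip_diff_l ip_sym by metis

lemma ip_unit_unit: "ip (unit_wt i) (unit_wt i) = 2 / eps i"
proof -
  have "(\<Sum>j\<in>UNIV. of_int (unit_wt i j * A i j)) = (\<Sum>j\<in>UNIV. if j = i then 2 else 0 :: real)"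
    by (rule sum.cong) (auto simp: unit_wt_def A_diag)
  then show ?thesis by (simp add: ip_unit)
qed

text \<open>\<open>phi k\<close> is \<open>2(\<rho>|k) - (k|k)\<close>.\<close>
definition phi :: "('i \<Rightarrow> int) \<Rightarrow> real" where
  "phi k = (\<Sum>i\<in>UNIV. 2 / eps i * of_int (k i)) - ip k k"

lemma phi_shift:
  "phi (shift i n k) = phi k + of_int n * (2 / eps i) - 2 * of_int n * ip (unit_wt i) k - of_int n * of_int n * (2 / eps i)"
  unfolding phi_def sum_shift ip_shift_l ip_shift_r ip_unit_unit ip_sym[of k "unit_wt i"]
  by (simp add: algebra_simps)

lemma phi_unit: "phi (unit_wt i) = 0"
proof -
  have "(\<Sum>j\<in>UNIV. 2 / eps j * of_int (unit_wt i j)) = (\<Sum>j\<in>UNIV. if j = i then 2 / eps j else 0)"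
    by (rule sum.cong) (auto simp: unit_wt_def)
  then show ?thesis by (simp add: phi_def ip_unit_unit)
qed

text \<open>The reflection step and the terminal case (k|k) <= 0 both give a strict inequality, so
  \<open>phi\<close> vanishes only at simple roots.\<close>

lemma phi_nonneg:
  assumes "x \<in> G k" "x \<noteq> 0" "0 < k"
  shows "0 \<le> phi k \<and> (phi k = 0 \<longrightarrow> (\<exists>i. k = unit_wt i))"
  using assms
proof (induction "nat (ht k)" arbitrary: k x rule: less_induct)
  case less
  have k: "\<And>j. 0 \<le> k j" using less.prems(3) by (simp add: pos_wt_iff)
  show ?case
  proof (cases "\<exists>i. 0 < ip (unit_wt i) k")
    case True
    then obtain i where i: "0 < ip (unit_wt i) k" by blast
    define m where "m = (\<Sum>j\<in>UNIV. k j * A i j)"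
    have ipm: "ip (unit_wt i) k = of_int m / eps i" by (simp add: m_def ip_unit)
    then have m: "0 < m" using i eps_pos[of i] by (simp add: zero_less_divide_iff)
    show ?thesis
    proof (cases "\<forall>j. j \<noteq> i \<longrightarrow> k j = 0")
      case True
      then have "k = unit_wt i"
        using pos_multiple_unit[OF G_pos[OF less.prems], of i] less.prems(2) by auto
      then show ?thesis by (auto simp: phi_unit)
    next
      case False
      then obtain j where j: "j \<noteq> i" "0 < k j" using k by (metis order_le_less)
      let ?k = "shift i (- m) k"
      have "wt k (coroot i) = of_nat (nat m)" using m by (simp add: wt_coroot m_def)
      then obtain y where y: "y \<in> G ?k" "y \<noteq> 0"
        using reflected_root[OF less.prems, of i "nat m"] m by auto
      \<comment> \<open>The reflection changes only coordinate \<open>i\<close>, so the positive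
        coordinate at \<open>j\<close> rules out a negative root.\<close>
      have kj: "?k j > 0" using j by (simp add: shift_def)
      then have "?k \<noteq> 0" by (metis less_irrefl zero_fun_apply)
      then have "0 < ?k \<or> 0 < - ?k" using G_sign y by blast
      moreover have "\<not> 0 < - ?k"
      proof
        assume "0 < - ?k"
        then have "0 \<le> (- ?k) j" unfolding pos_wt_iff by blast
        then show False using kj by (simp add: wt_apply)
      qed
      ultimately have pos: "0 < ?k" by blast
      have "nat (ht ?k) < nat (ht k)" using m ht_pos[OF less.prems(3)] by simp
      then have "0 \<le> phi ?k" using less.hyps y pos by blast
      \<comment> \<open>Reflection preserves (k|k); only the rho term drops, by m
        (alpha_i|alpha_i).\<close>
      moreover have "phi ?k = phi k - of_int m * (2 / eps i)"
        unfolding phi_shift ipm by (simp add: field_simps)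
      moreover have "0 < of_int m * (2 / eps i)" using m eps_pos[of i] by simp
      ultimately show ?thesis by linarith
    qed
  next
    case False
    then have "ip k k \<le> 0"
      unfolding ip_expand[of k] using k by (intro sum_nonpos mult_nonpos_nonneg) (auto simp: not_less)
    moreover obtain i where "0 < k i" using less.prems(3) by (auto simp: pos_wt_iff)
    then have "0 < (\<Sum>i\<in>UNIV. 2 / eps i * of_int (k i))"
      using k eps_pos by (intro sum_pos2[of _ i] mult_nonneg_nonneg mult_pos_pos) (auto simp: less_imp_le)
    ultimately show ?thesis by (auto simp: phi_def)
  qed
qed

section \<open>Opposite root spaces, and compatibility of the form with the involution\<close>

lemma Bf_inv_l: "Bf (br x y) z = - Bf y (br x z)"
  using Bf_inv[of y x z] br_anti[of x y] by (simp add: Bf_minus_l)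

lemma br_tv: "x \<in> G k \<Longrightarrow> br (tv l) x = sc (of_real (ip l k)) x"
  using br_H_G[OF _ tv_H] by (simp add: wt_tv)

text \<open>Both sides lie in \<open>H\<close> and pair equally with \<open>H\<close> by invariance,
  so nondegeneracy on \<open>H\<close> identifies them.\<close>

lemma br_opposite: assumes x: "x \<in> G k" and y: "y \<in> G (- k)" shows "br x y = sc (Bf x y) (tv k)"
proof -
  have "br x y \<in> H" using G_br[OF x y] by (simp add: G_0)
  then have "br x y - sc (Bf x y) (tv k) \<in> H"
    using subspace_diff[OF H_subspace] subspace_scale[OF H_subspace] tv_H by blast
  moreover have "Bf (br x y - sc (Bf x y) (tv k)) h = 0" if h: "h \<in> H" for h
  proof -
    have "Bf (br x y) h = Bf (br h x) y" using Bf_inv[of h x y] Bf_sym by metis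
    then show ?thesis using br_H_G[OF x h] Bf_tv[OF h] by (simp add: Bf_diff_l Bf_sc_l)
  qed
  ultimately show ?thesis using Bf_nondeg_H by (metis right_minus_eq)
qed

lemma Bf_ef: "Bf (e i) (f i) = of_real (eps i)"
proof -
  have "2 * Bf (e i) (f i) = Bf (br (coroot i) (e i)) (f i)"
    by (simp add: br_He[OF coroot_H] alpha_coroot A_diag Bf_sc_l)
  also have "\<dots> = Bf (coroot i) (coroot i)" unfolding Bf_inv by (simp add: br_ef)
  also have "\<dots> = of_real (eps i) * 2" by (simp add: Bf_coroot[OF coroot_H] alpha_coroot A_diag)
  finally show ?thesis by simp
qed

text \<open>Induction on how \<open>x\<close> is built: invariance moves the outer
  \<open>e i\<close> onto \<open>y\<close>, until \<open>x\<close> is a generator, whose opposite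
  root space is a line.\<close>

lemma pos_hermitian:
  "pos k x x' \<Longrightarrow> dual (- k) y y' \<Longrightarrow> Bf x' y' = cnj (Bf x y)"
proof (induction arbitrary: y y' rule: pos.induct)
  case (pos_gen i)
  have d: "dual (unit_wt i) y' y" using dual_sym[OF pos_gen] by simp
  show ?case
  proof (cases "y' = 0")
    case True
    then have "y = 0" using dual_0 d by blast
    then show ?thesis using True by simp
  next
    case False
    have "pos (unit_wt i) y' y" using G_pos[OF dual_G[OF d] False unit_wt_pos] om_eq[OF d] by simp
    then obtain c where "y' = sc c (e i)" "y = sc (cnj c) (- f i)"
      using pos_multiple_unit[of "unit_wt i" y' y i] by (auto simp: unit_wt_def)
    then show ?thesis by (simp add: Bf_sc_r Bf_minus_l Bf_minus_r Bf_ef Bf_sym[of "f i"])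
  qed
next
  case (pos_step k x x' i)
  have "dual (unit_wt i + - (k + unit_wt i)) (br (e i) y) (br (- f i) y')"
    using dual_br[OF dual_e pos_step.prems] .
  then have "dual (- k) (br (e i) y) (br (- f i) y')" by simp
  then show ?case using pos_step.IH by (simp add: Bf_inv_l)
qed (simp_all add: Bf_add_l Bf_sc_l)

lemma om_0 [simp]: "om 0 = 0"
  using om_eq[OF dual_scale[OF dual_e[of undefined], of 0]] by simp

lemma dual_om_or_0: "x \<in> G k \<Longrightarrow> k \<noteq> 0 \<Longrightarrow> x = 0 \<or> dual k x (om x)"
  using dual_om by blast

lemma om_G: "x \<in> G k \<Longrightarrow> k \<noteq> 0 \<Longrightarrow> om x \<in> G (- k)"
  using dual_om_or_0[of x k] dual_G[OF dual_sym] subspace_0[OF subspace_G] by auto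

lemma om_om: "x \<in> G k \<Longrightarrow> k \<noteq> 0 \<Longrightarrow> om (om x) = x"
  using dual_om_or_0[of x k] om_eq[OF dual_sym] by auto

lemma om_add: "x \<in> G k \<Longrightarrow> y \<in> G k \<Longrightarrow> k \<noteq> 0 \<Longrightarrow> om (x + y) = om x + om y"
  using dual_om_or_0[of x k] dual_om_or_0[of y k] om_eq[OF dual_add] by auto

lemma om_sc: "x \<in> G k \<Longrightarrow> k \<noteq> 0 \<Longrightarrow> om (sc c x) = sc (cnj c) (om x)"
  using dual_om_or_0[of x k] om_eq[OF dual_scale] by auto

lemma om_minus: "x \<in> G k \<Longrightarrow> k \<noteq> 0 \<Longrightarrow> om (- x) = - om x"
  using om_sc[of x k "-1"] by simp

lemma om_sum: "finite S \<Longrightarrow> (\<And>s. s \<in> S \<Longrightarrow> g s \<in> G k) \<Longrightarrow> k \<noteq> 0 \<Longrightarrow> om (sum g S) = (\<Sum>s\<in>S. om (g s))"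
proof (induction S rule: finite_induct)
  case (insert a S)
  have "sum g S \<in> G k" using insert.prems(1) by (intro subspace_sum[OF subspace_G]) simp
  then show ?case using insert om_add[of "g a" k "sum g S"] by simp
qed simp

lemma om_br: "x \<in> G k \<Longrightarrow> y \<in> G l \<Longrightarrow> k \<noteq> 0 \<Longrightarrow> l \<noteq> 0 \<Longrightarrow> om (br x y) = br (om x) (om y)"
  using dual_om_or_0[of x k] dual_om_or_0[of y l] om_eq[OF dual_br] by auto

lemma Bf_om:
  assumes x: "x \<in> G k" and y: "y \<in> G (- k)" and k: "k \<noteq> 0"
  shows "Bf (om x) (om y) = cnj (Bf x y)"
proof -
  have *: "Bf (om x) (om y) = cnj (Bf x y)" if "x \<in> G k" "y \<in> G (- k)" "0 < k" for x y k
  proof (cases "x = 0 \<or> y = 0")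
    case False
    then show ?thesis
      using that by (intro pos_hermitian[of k] G_pos dual_om) auto
  qed auto
  show ?thesis
  proof (cases "x = 0")
    case False
    then have "0 < k \<or> 0 < - k" using G_sign x k by blast
    then show ?thesis
    proof
      assume "0 < - k"
      then have "Bf (om y) (om x) = cnj (Bf y x)" using *[of y "- k" x] x y by simp
      then show ?thesis by (simp only: Bf_sym[of "om x"] Bf_sym[of x])
    qed (use * x y in blast)
  qed auto
qed

section \<open>Positivity of the Hermitian form\<close>

text \<open>The minus sign makes the norm of \<open>e i\<close> the positive number
  \<open>eps i\<close>, because \<open>om (e i) = - f i\<close>.\<close>

definition hf :: "'g \<Rightarrow> 'g \<Rightarrow> complex" where
  "hf x y = - Bf x (om y)"

definition sqn :: "'g \<Rightarrow> real" where
  "sqn x = Re (hf x x)"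

lemma hf_add_l: "hf (x + y) z = hf x z + hf y z"
  by (simp add: hf_def Bf_add_l)

lemma hf_sc_l: "hf (sc c x) y = c * hf x y"
  by (simp add: hf_def Bf_sc_l)

lemma hf_sum_l: "hf (sum g S) y = (\<Sum>s\<in>S. hf (g s) y)"
  by (simp add: hf_def Bf_sum_l sum_negf)

lemma hf_diff_l: "hf (x - y) z = hf x z - hf y z"
  by (simp add: hf_def Bf_diff_l)

lemma hf_0 [simp]: "hf 0 x = 0"
  by (simp add: hf_def)

lemma hf_sym: assumes "x \<in> G k" "y \<in> G k" "k \<noteq> 0" shows "hf y x = cnj (hf x y)"
proof -
  have "om y \<in> G (- k)" "om (om y) = y" using om_G om_om assms by auto
  then have "Bf y (om x) = cnj (Bf (om y) x)"
    using Bf_om[of "om y" "- k" x] assms by simp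
  then show ?thesis by (simp add: hf_def Bf_sym)
qed

lemma hf_sc_r: "x \<in> G k \<Longrightarrow> y \<in> G k \<Longrightarrow> k \<noteq> 0 \<Longrightarrow> hf x (sc c y) = cnj c * hf x y"
  by (simp add: hf_def om_sc Bf_sc_r)

lemma hf_diff_r: "x \<in> G k \<Longrightarrow> y \<in> G k \<Longrightarrow> z \<in> G k \<Longrightarrow> k \<noteq> 0 \<Longrightarrow> hf x (y - z) = hf x y - hf x z"
  using om_add[of y k "- z"] om_minus[of z k] subspace_neg[OF subspace_G, of z k]
  by (simp add: hf_def om_minus Bf_diff_r)

lemma hf_self: assumes "x \<in> G k" "k \<noteq> 0" shows "hf x x = of_real (sqn x)"
proof -
  have "hf x x = cnj (hf x x)" using hf_sym assms by blast
  then show ?thesis unfolding sqn_def by (simp add: complex_eq_iff)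
qed

definition posdef :: "('i \<Rightarrow> int) \<Rightarrow> bool" where
  "posdef k \<longleftrightarrow> (\<forall>x\<in>G k. x \<noteq> 0 \<longrightarrow> 0 < sqn x)"

text \<open>\<open>C\<close> may be dependent: a vector without orthogonal remainder adds nothing to
  \<open>B\<close>. The result is phrased as an expansion, the form in which bases enter the Casimir
  sum.\<close>

lemma gram_schmidt:
  assumes k: "k \<noteq> 0" "posdef k" and "finite C" "C \<subseteq> G k"
  shows "\<exists>B. finite B \<and> B \<subseteq> G k \<and> (\<forall>b\<in>B. \<forall>b'\<in>B. hf b b' = (if b = b' then 1 else 0))
    \<and> (\<forall>x\<in>C. x = (\<Sum>b\<in>B. sc (hf x b) b))"
  using assms(3,4)
proof (induction C rule: finite_induct)
  case empty
  then show ?case by (intro exI[of _ "{}"]) auto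
next
  case (insert v C)
  have "C \<subseteq> G k" using insert.prems by blast
  from insert.IH[OF this] obtain B where B: "finite B" "B \<subseteq> G k"
    "\<And>b b'. b \<in> B \<Longrightarrow> b' \<in> B \<Longrightarrow> hf b b' = (if b = b' then 1 else 0)"
    "\<And>x. x \<in> C \<Longrightarrow> x = (\<Sum>b\<in>B. sc (hf x b) b)" by blast
  have v: "v \<in> G k" using insert.prems by simp
  define p where "p = (\<Sum>b\<in>B. sc (hf v b) b)"
  define w where "w = v - p"
  have p: "p \<in> G k" unfolding p_def using B(2)
    by (intro subspace_sum[OF subspace_G] subspace_scale[OF subspace_G]) auto
  have w: "w \<in> G k" unfolding w_def using v p subspace_diff[OF subspace_G] by blast
  have wb: "hf w b = 0" if b: "b \<in> B" for b
  proof -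
    have "hf p b = (\<Sum>b'\<in>B. if b' = b then hf v b' else 0)"
      unfolding p_def hf_sum_l by (rule sum.cong) (auto simp: hf_sc_l B(3) b)
    then show ?thesis using b B(1) by (simp add: w_def hf_diff_l)
  qed
  show ?case
  proof (cases "w = 0")
    case True
    then have "v = (\<Sum>b\<in>B. sc (hf v b) b)" by (simp add: w_def p_def)
    then have vC: "\<forall>x\<in>insert v C. x = (\<Sum>b\<in>B. sc (hf x b) b)" using B(4) by blast
    show ?thesis by (intro exI[of _ B] conjI B(1,2) vC) (intro ballI B(3))
  next
    case False
    define r where "r = sqrt (sqn w)"
    have r: "0 < r" "r * r = sqn w" using False w k(2) by (auto simp: r_def posdef_def)
    define u where "u = sc (of_real (inverse r)) w"
    have u: "u \<in> G k" unfolding u_def using w by (rule subspace_scale[OF subspace_G])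
    have ub: "hf u b = 0" if "b \<in> B" for b using wb[OF that] by (simp add: u_def hf_sc_l)
    have bu: "hf b u = 0" if "b \<in> B" for b
      using ub[OF that] hf_sym[of u k b] u B(2) k that by auto
    have wu: "hf w u = of_real r"
      unfolding u_def hf_sc_r[OF w w k(1)] hf_self[OF w k(1)] r(2)[symmetric] using r(1) by simp
    have uu: "hf u u = 1"
    proof -
      have "hf u u = of_real (inverse r) * hf w u" by (simp add: u_def hf_sc_l)
      then show ?thesis using r(1) by (simp add: wu)
    qed
    have uB: "u \<notin> B" using uu ub by auto
    have x: "x = (\<Sum>b\<in>insert u B. sc (hf x b) b)" if "x \<in> C" for x
    proof -
      have "hf x u = hf (\<Sum>b\<in>B. sc (hf x b) b) u" using B(4)[OF that] by simp
      also have "\<dots> = 0" unfolding hf_sum_l using bu by (intro sum.neutral) (auto simp: hf_sc_l)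
      finally show ?thesis using B(4)[OF that] B(1) uB by simp
    qed
    have "hf v u = hf w u + hf p u" by (simp add: w_def hf_diff_l)
    also have "hf p u = 0" unfolding p_def hf_sum_l using bu by (intro sum.neutral) (auto simp: hf_sc_l)
    finally have "hf v u = of_real r" by (simp add: wu)
    then have "sc (hf v u) u = w" using r(1) by (simp add: u_def)
    then have "v = (\<Sum>b\<in>insert u B. sc (hf v b) b)"
      using B(1) uB by (simp add: w_def p_def)
    then have "\<forall>x\<in>insert v C. x = (\<Sum>b\<in>insert u B. sc (hf x b) b)" using x by blast
    moreover have "\<forall>b\<in>insert u B. \<forall>b'\<in>insert u B. hf b b' = (if b = b' then 1 else 0)"
      using B(3) ub bu uu uB by auto
    moreover have "finite (insert u B)" "insert u B \<subseteq> G k" using B(1,2) u by auto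
    ultimately show ?thesis by (intro exI[of _ "insert u B"] conjI)
  qed
qed

text \<open>A basis \<open>B\<close> orthonormal for \<open>hf\<close> is dual under
  \<open>Bf\<close> to its negated images under \<open>om\<close>. The second expansion is
  \<open>om\<close> applied to the first.\<close>

lemma dual_bases:
  assumes k: "0 < k" "posdef k"
  shows "\<exists>B. finite B \<and> B \<subseteq> G k \<and> (\<forall>x\<in>G k. x = (\<Sum>b\<in>B. sc (Bf x (- om b)) b))
    \<and> (\<forall>y\<in>G (- k). y = (\<Sum>b\<in>B. sc (Bf b y) (- om b)))"
proof -
  have k0: "k \<noteq> 0" using k by auto
  obtain C where C: "C \<subseteq> G k" "independent C" "G k \<subseteq> span C"
    using maximal_independent_subset by blast
  have "G k \<subseteq> span (words (nat (ht k) - 1))"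
  proof
    fix x assume "x \<in> G k"
    then show "x \<in> span (words (nat (ht k) - 1))"
      using pos_span_words[OF G_pos[of x k]] k(1) by (cases "x = 0") (auto intro: span_zero)
  qed
  then have "finite C" using independent_span_bound[OF finite_words C(2)] C(1) by blast
  from gram_schmidt[OF k0 k(2) this C(1)] obtain B where B: "finite B" "B \<subseteq> G k"
    "\<And>x. x \<in> C \<Longrightarrow> x = (\<Sum>b\<in>B. sc (hf x b) b)" by blast
  have 1: "x = (\<Sum>b\<in>B. sc (hf x b) b)" if "x \<in> span C" for x
    using that
  proof (induction rule: span_induct)
    case base
    show ?case
      by (auto simp: subspace_def hf_add_l hf_sc_l scale_left_distrib sum.distrib
          simp flip: scale_scale scale_sum_right)
  qed (rule B(3))
  have 2: "y = (\<Sum>b\<in>B. sc (Bf b y) (- om b))" if y: "y \<in> G (- k)" for y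
  proof -
    have oy: "om y \<in> G k" "om (om y) = y" using om_G[OF y] om_om[OF y] k0 by auto
    have hb: "cnj (hf (om y) b) = - Bf b y" if "b \<in> B" for b
      using Bf_om[OF y, of b] B(2) that k0 by (auto simp: hf_def Bf_sym)
    have "y = om (\<Sum>b\<in>B. sc (hf (om y) b) b)" using 1[of "om y"] C(3) oy by auto
    also have "\<dots> = (\<Sum>b\<in>B. om (sc (hf (om y) b) b))"
      using B(1,2) k0 by (intro om_sum[of _ _ k]) (auto intro: subspace_scale[OF subspace_G])
    also have "\<dots> = (\<Sum>b\<in>B. sc (Bf b y) (- om b))"
      using B(2) k0 by (intro sum.cong refl) (auto simp: om_sc[of _ k] hb)
    finally show ?thesis .
  qed
  have 3: "\<forall>x\<in>G k. x = (\<Sum>b\<in>B. sc (Bf x (- om b)) b)"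
    using 1 C(3) unfolding hf_def Bf_minus_r by blast
  show ?thesis by (intro exI[of _ B] conjI B(1,2) 3) (intro ballI 2)
qed

lemma G_trivial: assumes "x \<in> G k" "\<not> 0 < k" "k \<noteq> 0" "\<not> 0 < - k" shows "x = 0"
  using G_sign assms by blast

lemma G_trivial_ht: assumes "x \<in> G k" "\<not> 0 < k" "k \<noteq> 0" "0 \<le> ht k" shows "x = 0"
proof (rule G_trivial[OF assms(1-3)])
  show "\<not> 0 < - k" using ht_pos[of "- k"] assms(4) by (auto simp: ht_minus)
qed

text \<open>The part of the Casimir operator over \<open>\<nn>\<^sub>+\<close>. By induction on the height and telescoping, both sides have
  the same commutators with all \<open>f\<^sub>j\<close>.\<close>
lemma casimir:
  fixes BB :: "('i \<Rightarrow> int) \<Rightarrow> 'g set" and n :: int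
  assumes fin: "\<And>g. finite (BB g)"
    and BB_G: "\<And>g b. b \<in> BB g \<Longrightarrow> b \<in> G g"
    and st_G: "\<And>g b. b \<in> BB g \<Longrightarrow> st b \<in> G (- g)"
    and BB_pos: "\<And>g. \<not> 0 < g \<Longrightarrow> BB g = {}"
    and ex1: "\<And>g x. 0 < g \<Longrightarrow> ht g < n \<Longrightarrow> x \<in> G g \<Longrightarrow> x = (\<Sum>b\<in>BB g. sc (Bf x (st b)) b)"
    and ex2: "\<And>g y. 0 < g \<Longrightarrow> ht g < n \<Longrightarrow> y \<in> G (- g) \<Longrightarrow> y = (\<Sum>b\<in>BB g. sc (Bf b y) (st b))"
    and k: "0 < k" "ht k \<le> n" and x: "x \<in> G k"
  shows "(\<Sum>g | 0 < g \<and> 0 < k - g. \<Sum>b\<in>BB g. br b (br (st b) x)) = sc (of_real (phi k)) x"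
  using k x
proof (induction "nat (ht k)" arbitrary: k x rule: less_induct)
  case less
  let ?R = "\<lambda>k. {g. 0 < g \<and> 0 < k - g}"
  define C where "C k x = (\<Sum>g\<in>?R k. \<Sum>b\<in>BB g. br b (br (st b) x))" for k x
  define d where "d = C k x - sc (of_real (phi k)) x"
  have hk: "0 < ht k" using ht_pos less.prems(1) by blast
  have htR: "ht g < n" if "g \<in> ?R k" for g
    using that ht_pos[of "k - g"] less.prems(2) by (auto simp: ht_diff)
  have term_G: "br b (br (st b) x) \<in> G k" if "b \<in> BB g" for b g
    using G_br[OF BB_G[OF that] G_br[OF st_G[OF that] less.prems(3)]] by simp
  then have C_G: "C k x \<in> G k"
    unfolding C_def by (intro subspace_sum[OF subspace_G]) auto
  have d_G: "d \<in> G k" unfolding d_def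
    using C_G less.prems(3) subspace_diff[OF subspace_G] subspace_scale[OF subspace_G] by blast
  \<comment> \<open>At height 1, [f_j, x] can lie in \<open>H\<close>, out of reach of the
    induction; that height is treated directly at the end.\<close>
  have "br (f j) d = 0" if k1: "ht k \<noteq> 1" for j
  proof -
    let ?u = "unit_wt j"
    let ?l = "k - ?u"
    define x' where "x' = br (f j) x"
    have x'_G: "x' \<in> G ?l" using G_br[OF f_G less.prems(3), of j] by (simp add: x'_def)
    have l0: "?l \<noteq> 0" using k1 by auto
    have lht: "ht ?l = ht k - 1" by (simp add: ht_diff)
    show ?thesis
    proof (cases "0 < ?l")
      case False
      have "br (f j) d \<in> G ?l" using G_br[OF f_G d_G, of j] by simp
      then show ?thesis using G_trivial_ht[OF _ False l0] hk lht by simp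
    next
      case l: True
      \<comment> \<open>The three places where \<open>f j\<close> can act in a term: on
        \<open>b\<close>, on \<open>st b\<close>, and on \<open>x\<close>.\<close>
      define P where "P g = (\<Sum>b\<in>BB g. br (br (f j) b) (br (st b) x))" for g
      define Q where "Q g = (\<Sum>b\<in>BB g. br b (br (br (f j) (st b)) x))" for g
      define T where "T g = (\<Sum>b\<in>BB g. br b (br (st b) x'))" for g
      have split: "br (f j) (C k x) = sum P (?R k) + sum Q (?R k) + sum T (?R k)"
        unfolding C_def P_def Q_def T_def x'_def br_sum_r sum.distrib[symmetric]
        by (intro sum.cong refl) (simp add: br_leibniz[of "f j"] br_add_r)
      have fst_G: "br (f j) (st b) \<in> G (- ?u - g)" if "b \<in> BB g" for b g
        using G_br[OF f_G st_G[OF that], of j] by simp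
      have uR: "?u \<in> ?R k" using l unit_wt_pos by auto
      have lR: "?l \<in> ?R k" using l unit_wt_pos[of j] by auto
      have not_below: "\<not> 0 < - (?l - g)" if "g \<in> ?R k" for g
      proof
        assume "0 < - (?l - g)"
        then have "0 < ht (- (?l - g))" by (rule ht_pos)
        moreover have "0 < ht (k - g)" using that by (intro ht_pos) auto
        ultimately show False by (simp add: ht_diff ht_minus)
      qed

      \<comment> \<open>The index l occurs in the sum for k but not in the one for l; there
        [st b, x'] lies in \<open>H\<close> and contributes (l|l).\<close>
      have T_l: "T ?l = sc (of_real (ip ?l ?l)) x'"
      proof -
        have "br b (br (st b) x') = sc (of_real (ip ?l ?l)) (sc (Bf x' (st b)) b)" if b: "b \<in> BB ?l" for b
        proof -
          have "br (st b) x' = - sc (Bf x' (st b)) (tv ?l)"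
            using br_opposite[OF x'_G st_G[OF b]] br_anti[of "st b" x'] by simp
          then show ?thesis
            using br_tv[OF BB_G[OF b], of ?l] br_anti[of b "tv ?l"]
            by (simp add: br_minus_r br_sc_r mult.commute)
        qed
        then have "T ?l = sc (of_real (ip ?l ?l)) (\<Sum>b\<in>BB ?l. sc (Bf x' (st b)) b)"
          unfolding T_def scale_sum_right by (intro sum.cong refl)
        then show ?thesis using ex1[OF l _ x'_G] htR[OF lR] by metis
      qed
      have T_0: "T g = 0" if g: "g \<in> ?R k" "g \<noteq> ?l" "\<not> 0 < ?l - g" for g
        unfolding T_def
      proof (intro sum.neutral ballI)
        fix b assume b: "b \<in> BB g"
        have "br (st b) x' \<in> G (?l - g)" using G_br[OF st_G[OF b] x'_G] by (simp add: algebra_simps)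
        then have "br (st b) x' = 0"
          using G_trivial[OF _ g(3) _ not_below[OF g(1)]] g(2) by auto
        then show "br b (br (st b) x') = 0" by simp
      qed
      have subR: "?R ?l \<subseteq> ?R k"
      proof
        fix g assume "g \<in> ?R ?l"
        then show "g \<in> ?R k" using pos_wt_add[of "?l - g" ?u] unit_wt_pos[of j] by (auto simp: algebra_simps)
      qed
      have sum_T: "sum T (?R k) = sc (of_real (phi ?l + ip ?l ?l)) x'"
      proof -
        have "sum T (?R k) = sum T (insert ?l (?R ?l))"
          using T_0 lR subR by (intro sum.mono_neutral_right finite_between) auto
        also have "\<dots> = T ?l + sum T (?R ?l)" by (rule sum.insert[OF finite_between]) simp
        also have "sum T (?R ?l) = C ?l x'" unfolding C_def T_def ..
        also have "C ?l x' = sc (of_real (phi ?l)) x'"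
          unfolding C_def using lht hk less.prems(2) by (intro less.hyps l x'_G) auto
        finally show ?thesis by (simp add: T_l scale_left_distrib add.commute)
      qed

      \<comment> \<open>For g = alpha_j the bracket of \<open>f j\<close> with \<open>b\<close>
        falls into \<open>H\<close>; no term of \<open>Q\<close> cancels it.\<close>
      have P_u: "P ?u = sc (- of_real (ip ?u ?l)) x'"
      proof -
        have "br (br (f j) b) (br (st b) x) = - br (tv ?u) (br (sc (Bf b (f j)) (st b)) x)"
          if b: "b \<in> BB ?u" for b
          using br_opposite[OF BB_G[OF b] f_G] br_anti[of "f j" b]
          by (simp add: br_minus_l br_sc_l br_sc_r)
        then have "P ?u = - br (tv ?u) (br (\<Sum>b\<in>BB ?u. sc (Bf b (f j)) (st b)) x)"
          unfolding P_def br_sum_l br_sum_r sum_negf[symmetric] by (intro sum.cong refl)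
        also have "(\<Sum>b\<in>BB ?u. sc (Bf b (f j)) (st b)) = f j"
          using ex2[OF unit_wt_pos htR[OF uR] f_G] by simp
        finally show ?thesis using br_tv[OF x'_G, of ?u] by (simp add: x'_def)
      qed
      \<comment> \<open>At the other end [[f_j, st b], x] falls into \<open>H\<close>; this too
        survives the telescoping.\<close>
      have Q_l: "Q ?l = sc (- of_real (ip k ?l)) x'"
      proof -
        have "br b (br (br (f j) (st b)) x) = sc (- of_real (ip k ?l)) (sc (Bf x' (st b)) b)"
          if b: "b \<in> BB ?l" for b
        proof -
          have "br (br (f j) (st b)) x = - sc (Bf x (br (f j) (st b))) (tv k)"
            using br_opposite[OF less.prems(3), of "br (f j) (st b)"] fst_G[OF b]
              br_anti[of "br (f j) (st b)" x] by simp
          moreover have "Bf x (br (f j) (st b)) = - Bf x' (st b)"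
            unfolding x'_def Bf_inv_l by simp
          ultimately have "br b (br (br (f j) (st b)) x) = sc (Bf x' (st b)) (br b (tv k))"
            by (simp add: br_sc_r)
          also have "br b (tv k) = sc (- of_real (ip k ?l)) b"
            using br_tv[OF BB_G[OF b], of k] br_anti[of b "tv k"] by simp
          finally show ?thesis by (simp add: mult.commute)
        qed
        then have "Q ?l = sc (- of_real (ip k ?l)) (\<Sum>b\<in>BB ?l. sc (Bf x' (st b)) b)"
          unfolding Q_def scale_sum_right by (intro sum.cong refl)
        then show ?thesis using ex1[OF l _ x'_G] htR[OF lR] by metis
      qed

      \<comment> \<open>Expanding [f_j, b] and [f_j, st c] in the dual bases gives the same matrix
        up to sign, by invariance of the form.\<close>
      have PQ: "P g = - Q (g - ?u)" if g: "g \<in> ?R k" "g \<noteq> ?u" for g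
      proof (cases "0 < g - ?u")
        case True
        let ?h = "g - ?u"
        have h: "ht ?h < n" using htR[OF g(1)] by (simp add: ht_diff)
        have gpos: "0 < g" using g(1) by simp
        have 1: "br (f j) b = (\<Sum>c\<in>BB ?h. sc (Bf (br (f j) b) (st c)) c)" if "b \<in> BB g" for b
          using G_br[OF f_G BB_G[OF that], of j] by (intro ex1[OF True h]) simp
        have 2: "br (f j) (st c) = (\<Sum>b\<in>BB g. sc (Bf b (br (f j) (st c))) (st b))" if "c \<in> BB ?h" for c
          using fst_G[OF that] by (intro ex2[OF gpos htR[OF g(1)]]) simp
        have "P g = (\<Sum>b\<in>BB g. \<Sum>c\<in>BB ?h. sc (Bf (br (f j) b) (st c)) (br c (br (st b) x)))"
          unfolding P_def
        proof (rule sum.cong[OF refl])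
          fix b assume "b \<in> BB g"
          from arg_cong[OF 1[OF this], of "\<lambda>z. br z (br (st b) x)"]
          show "br (br (f j) b) (br (st b) x) = (\<Sum>c\<in>BB ?h. sc (Bf (br (f j) b) (st c)) (br c (br (st b) x)))"
            unfolding br_sum_l br_sc_l .
        qed
        also have "\<dots> = (\<Sum>c\<in>BB ?h. \<Sum>b\<in>BB g. sc (Bf (br (f j) b) (st c)) (br c (br (st b) x)))"
          by (rule sum.swap)
        also have "\<dots> = - (\<Sum>c\<in>BB ?h. \<Sum>b\<in>BB g. sc (Bf b (br (f j) (st c))) (br c (br (st b) x)))"
          unfolding sum_negf[symmetric] by (intro sum.cong refl) (simp add: Bf_inv_l)
        also have "(\<Sum>c\<in>BB ?h. \<Sum>b\<in>BB g. sc (Bf b (br (f j) (st c))) (br c (br (st b) x))) = Q ?h"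
          unfolding Q_def
        proof (rule sum.cong[OF refl])
          fix c assume "c \<in> BB ?h"
          from arg_cong[OF 2[OF this], of "\<lambda>z. br c (br z x)"]
          show "(\<Sum>b\<in>BB g. sc (Bf b (br (f j) (st c))) (br c (br (st b) x))) = br c (br (br (f j) (st c)) x)"
            unfolding br_sum_l br_sum_r br_sc_l br_sc_r by (rule sym)
        qed
        finally show ?thesis .
      next
        case False
        have "0 \<le> ht (g - ?u)" using ht_pos[of g] g(1) by (simp add: ht_diff)
        have "br (br (f j) b) (br (st b) x) = 0" if "b \<in> BB g" for b
        proof -
          have "br (f j) b \<in> G (g - ?u)" using G_br[OF f_G BB_G[OF that], of j] by simp
          then have "br (f j) b = 0"
            using G_trivial_ht[OF _ False _ \<open>0 \<le> ht (g - ?u)\<close>] g(2) by simp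
          then show ?thesis by simp
        qed
        then have "P g = 0" unfolding P_def by (intro sum.neutral) blast
        moreover have "Q (g - ?u) = 0" unfolding Q_def using BB_pos[OF False] by simp
        ultimately show ?thesis by simp
      qed
      have Q_0: "Q h = 0" if h: "h \<in> ?R k" "h \<noteq> ?l" "\<not> 0 < ?l - h" for h
        unfolding Q_def
      proof (intro sum.neutral ballI)
        fix b assume b: "b \<in> BB h"
        have "br (br (f j) (st b)) x \<in> G (?l - h)"
          using G_br[OF fst_G[OF b] less.prems(3)] by (simp add: algebra_simps)
        then have "br (br (f j) (st b)) x = 0"
          using G_trivial[OF _ h(3) _ not_below[OF h(1)]] h(2) by auto
        then show "br b (br (br (f j) (st b)) x) = 0" by simp
      qed
      have sum_PQ: "sum P (?R k) + sum Q (?R k) = sc (of_real (- ip ?u ?l - ip k ?l)) x'"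
      proof -
        \<comment> \<open>\<open>S\<close> and the range without l differ only by indices where
          \<open>Q\<close> vanishes: a nonpositive index has an empty basis, and otherwise the inner
          bracket lies in a weight space that is zero.\<close>
        define S where "S = (\<lambda>g. g - ?u) ` (?R k - {?u})"
        have fS: "finite S" unfolding S_def using finite_between by blast
        have "sum P (?R k) = P ?u + sum P (?R k - {?u})"
          by (rule sum.remove[OF finite_between uR])
        also have "sum P (?R k - {?u}) = - (\<Sum>g\<in>?R k - {?u}. Q (g - ?u))"
          unfolding sum_negf[symmetric] by (rule sum.cong[OF refl]) (use PQ in auto)
        also have "(\<Sum>g\<in>?R k - {?u}. Q (g - ?u)) = sum Q S"
          unfolding S_def by (subst sum.reindex) (auto simp: inj_on_def)
        also have "sum Q S = sum Q (S \<inter> (?R k - {?l}))"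
        proof (rule sum.mono_neutral_right[OF fS])
          show "\<forall>h\<in>S - S \<inter> (?R k - {?l}). Q h = 0"
          proof
            fix h assume h: "h \<in> S - S \<inter> (?R k - {?l})"
            then obtain g where g: "g \<in> ?R k" "h = g - ?u" unfolding S_def by blast
            then have "0 < ?l - h" by simp
            moreover have "0 < k - h" using pos_wt_add[OF \<open>0 < ?l - h\<close> unit_wt_pos[of j]] by simp
            ultimately have "\<not> 0 < h" using h by auto
            then show "Q h = 0" unfolding Q_def using BB_pos by simp
          qed
        qed auto
        also have "\<dots> = sum Q (?R k - {?l})"
        proof (rule sum.mono_neutral_left)
          show "finite (?R k - {?l})" using finite_between by blast
          show "\<forall>h\<in>?R k - {?l} - S \<inter> (?R k - {?l}). Q h = 0"
          proof
            fix h assume h: "h \<in> ?R k - {?l} - S \<inter> (?R k - {?l})"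
            have "\<not> 0 < ?l - h"
            proof
              assume a: "0 < ?l - h"
              have "h + ?u \<in> ?R k - {?u}"
                using a h pos_wt_add[of h ?u] unit_wt_pos[of j] by (auto simp: algebra_simps)
              then have "h \<in> S" unfolding S_def by (intro image_eqI[of _ _ "h + ?u"]) auto
              then show False using h by blast
            qed
            then show "Q h = 0" using Q_0 h by blast
          qed
        qed auto
        finally have "sum P (?R k) + sum Q (?R k) = P ?u + Q ?l"
          using sum.remove[OF finite_between lR, of Q] by simp
        then show ?thesis unfolding P_u Q_l by (simp add: scale_left_diff_distrib)
      qed
      have l_shift: "?l = shift j (- 1) k" by (simp add: diff_unit_wt)
      \<comment> \<open>With l = k - alpha_j the boundary terms sum to -2(alpha_j|l). This is phi(k)
        - phi(l), because 2(rho|alpha_j) = (alpha_j|alpha_j).\<close>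
      have "- ip ?u ?l - ip k ?l + (phi ?l + ip ?l ?l) = phi k"
        unfolding ip_diff_l ip_diff_r ip_sym[of k ?u] ip_unit_unit
        unfolding l_shift phi_shift by simp
      then have "br (f j) (C k x) = sc (of_real (phi k)) x'"
        unfolding split sum_PQ sum_T scale_left_distrib[symmetric] of_real_add[symmetric] by simp
      then show ?thesis by (simp add: d_def br_diff_r br_sc_r x'_def)
    qed
  qed
  then have "d = 0" if "ht k \<noteq> 1"
    using annihilated_zero[OF d_G hk] that by blast
  moreover have "d = 0" if "ht k = 1"
  proof -
    have "?R k = {}"
    proof (intro equals0I)
      fix g assume "g \<in> ?R k"
      then show False using ht_pos[of g] ht_pos[of "k - g"] that by (simp add: ht_diff)
    qed
    moreover have "phi k = 0" using ht_1[OF less.prems(1) that] phi_unit by auto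
    ultimately have "C k x = 0" unfolding C_def by (simp only: sum.empty)
    then show ?thesis by (simp add: d_def \<open>phi k = 0\<close>)
  qed
  ultimately show ?case unfolding d_def C_def by auto
qed

theorem posdef_pos: "0 < k \<Longrightarrow> posdef k"
proof (induction "nat (ht k)" arbitrary: k rule: less_induct)
  case (less k)
  have hk: "0 < ht k" using ht_pos less.prems by blast
  have k0: "k \<noteq> 0" using less.prems by auto
  have IH: "posdef g" if "0 < g" "ht g < ht k" for g
    using that hk by (intro less.hyps) auto
  show ?case
    unfolding posdef_def
  proof (intro ballI impI)
    fix x assume x: "x \<in> G k" "x \<noteq> 0"
    show "0 < sqn x"
    proof (cases "\<exists>i. k = unit_wt i")
      case True
      then obtain i where i: "k = unit_wt i" by blast
      then obtain c where c: "x = sc c (e i)" "om x = sc (cnj c) (- f i)"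
        using pos_multiple_unit[OF G_pos[OF x less.prems], of i] by (auto simp: unit_wt_def)
      have "hf x x = (c * cnj c) * of_real (eps i)"
        unfolding hf_def c(2) by (simp add: c(1) Bf_sc_l Bf_sc_r Bf_minus_r Bf_ef)
      also have "\<dots> = of_real ((cmod c)\<^sup>2 * eps i)"
        by (simp only: complex_norm_square[symmetric] of_real_mult)
      finally have "sqn x = (cmod c)\<^sup>2 * eps i" by (simp add: sqn_def)
      moreover have "c \<noteq> 0" using c x by auto
      ultimately show ?thesis using eps_pos by simp
    next
      case False
      have phi: "0 < phi k" using phi_nonneg[OF x less.prems] False by force
      let ?R = "{g. 0 < g \<and> 0 < k - g}"
      have htR: "ht g < ht k" if "g \<in> ?R" for g
        using that ht_pos[of "k - g"] by (auto simp: ht_diff)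
      define basis where "basis g B \<longleftrightarrow> finite B \<and> B \<subseteq> G g \<and>
        (\<forall>x\<in>G g. x = (\<Sum>b\<in>B. sc (Bf x (- om b)) b)) \<and> (\<forall>y\<in>G (- g). y = (\<Sum>b\<in>B. sc (Bf b y) (- om b)))" for g B
      \<comment> \<open>Below the height of \<open>k\<close> the induction supplies dual bases; the
        empty set elsewhere meets the conditions of \<open>casimir\<close>.\<close>
      define BB where "BB g = (if 0 < g \<and> ht g < ht k then SOME B. basis g B else {})" for g
      have BB: "basis g (BB g)" if "0 < g" "ht g < ht k" for g
      proof -
        have "\<exists>B. basis g B" unfolding basis_def using dual_bases[OF that(1) IH[OF that]] .
        then show ?thesis using that by (simp add: BB_def someI_ex)
      qed
      have BB_cases: "0 < g \<and> ht g < ht k" if "b \<in> BB g" for b g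
        using that by (auto simp: BB_def split: if_splits)
      have BB_G: "b \<in> G g" if "b \<in> BB g" for b g
        using BB[of g] BB_cases[OF that] that unfolding basis_def by blast
      have st_G: "- om b \<in> G (- g)" if "b \<in> BB g" for b g
        using BB_cases[OF that] om_G[OF BB_G[OF that]] subspace_neg[OF subspace_G] by blast
      have fin: "finite (BB g)" for g
        using BB[of g] by (cases "0 < g \<and> ht g < ht k") (auto simp: BB_def basis_def)
      have ex2: "y = (\<Sum>b\<in>BB g. sc (Bf b y) (- om b))" if "0 < g" "ht g < ht k" "y \<in> G (- g)" for g y
        using BB[OF that(1,2)] that(3) unfolding basis_def by blast
      define Z where "Z b = br (- om b) x" for b
      have Z_G: "Z b \<in> G (k - g)" if "b \<in> BB g" for b g
        using G_br[OF st_G[OF that] x(1)] by (simp add: Z_def)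
      have "sc (of_real (phi k)) x = (\<Sum>g\<in>?R. \<Sum>b\<in>BB g. br b (Z b))"
        unfolding Z_def
      proof (rule casimir[symmetric, where n = "ht k"])
        show "z = (\<Sum>b\<in>BB g. sc (Bf z (- om b)) b)" if "0 < g" "ht g < ht k" "z \<in> G g" for g z
          using BB[OF that(1,2)] that(3) unfolding basis_def by blast
      qed (use fin BB_G st_G ex2 x less.prems in \<open>auto simp: BB_def\<close>)
      from arg_cong[OF this, of "\<lambda>z. hf z x"]
      have "of_real (phi k) * hf x x = (\<Sum>g\<in>?R. \<Sum>b\<in>BB g. hf (br b (Z b)) x)"
        unfolding hf_sc_l hf_sum_l .
      also have "\<dots> = (\<Sum>g\<in>?R. \<Sum>b\<in>BB g. of_real (sqn (Z b)))"
      proof (intro sum.cong refl)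
        fix g b assume g: "g \<in> ?R" and b: "b \<in> BB g"
        have g0: "g \<noteq> 0" "k - g \<noteq> 0" using g by auto
        \<comment> \<open>This makes ad b the adjoint of ad (- om b) for \<open>hf\<close>, so each
          term becomes the norm of \<open>Z b\<close>.\<close>
        have "om (br (om b) x) = br b (om x)"
          using om_br[OF om_G[OF BB_G[OF b] g0(1)] x(1)] om_om[OF BB_G[OF b] g0(1)] g0 k0 by simp
        then have "om (Z b) = - br b (om x)"
          using om_minus[OF Z_G[OF b] g0(2)] by (simp add: Z_def br_minus_l)
        then have "hf (br b (Z b)) x = hf (Z b) (Z b)"
          by (simp add: hf_def Bf_inv_l Bf_minus_r)
        then show "hf (br b (Z b)) x = of_real (sqn (Z b))"
          using hf_self[OF Z_G[OF b] g0(2)] by simp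
      qed
      finally have "of_real (phi k * sqn x) = (of_real (\<Sum>g\<in>?R. \<Sum>b\<in>BB g. sqn (Z b)) :: complex)"
        using hf_self[OF x(1) k0] by simp
      then have eq: "phi k * sqn x = (\<Sum>g\<in>?R. \<Sum>b\<in>BB g. sqn (Z b))"
        by (simp only: of_real_eq_iff)
      have pd: "0 \<le> sqn (Z b) \<and> (Z b \<noteq> 0 \<longrightarrow> 0 < sqn (Z b))" if "g \<in> ?R" "b \<in> BB g" for g b
      proof (cases "Z b = 0")
        case True
        then show ?thesis by (simp add: sqn_def)
      next
        case False
        have "posdef (k - g)" using that(1) ht_pos[of g] by (intro IH) (auto simp: ht_diff)
        then show ?thesis using Z_G[OF that(2)] False unfolding posdef_def by force
      qed
      \<comment> \<open>For strictness: [f_j, x] is a combination of the \<open>Z b\<close> with b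
        of weight alpha_j, so one of these is nonzero.\<close>
      obtain j where j: "br (f j) x \<noteq> 0" using annihilated_zero[OF x(1) hk] x(2) by blast
      have "br (f j) x \<in> G (k - unit_wt j)" using G_br[OF f_G x(1), of j] by simp
      then have "0 < k - unit_wt j"
        using G_trivial_ht j False hk by (metis diff_ge_0_iff_ge eq_iff_diff_eq_0 ht_diff ht_unit_wt int_one_le_iff_zero_less)
      then have uR: "unit_wt j \<in> ?R" using unit_wt_pos by auto
      have "\<exists>b\<in>BB (unit_wt j). Z b \<noteq> 0"
      proof (rule ccontr)
        assume no: "\<not> ?thesis"
        from arg_cong[OF ex2[OF unit_wt_pos htR[OF uR] f_G], of "\<lambda>y. br y x"]
        have "br (f j) x = (\<Sum>b\<in>BB (unit_wt j). sc (Bf b (f j)) (Z b))"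
          unfolding Z_def br_sum_l br_sc_l .
        also have "\<dots> = 0" using no by (intro sum.neutral) auto
        finally show False using j by simp
      qed
      then obtain b where b: "b \<in> BB (unit_wt j)" "Z b \<noteq> 0" by blast
      have "0 < (\<Sum>b\<in>BB (unit_wt j). sqn (Z b))"
        using pd[OF uR] b by (intro sum_pos2[OF fin b(1)]) auto
      then have "0 < (\<Sum>g\<in>?R. \<Sum>b\<in>BB g. sqn (Z b))"
        using pd by (intro sum_pos2[OF finite_between uR] sum_nonneg) blast+
      then have "0 < phi k * sqn x" using eq by simp
      then show ?thesis using phi by (simp add: zero_less_mult_iff)
    qed
  qed
qed

text \<open>\<open>om\<close> carries a negative root space to a positive one and preserves
  \<open>sqn\<close>.\<close>

corollary posdef_root: assumes "k \<noteq> 0" shows "posdef k"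
  unfolding posdef_def
proof (intro ballI impI)
  fix x assume x: "x \<in> G k" "x \<noteq> 0"
  then consider "0 < k" | "0 < - k" using G_sign assms by blast
  then show "0 < sqn x"
  proof cases
    case 1
    then show ?thesis using posdef_pos x unfolding posdef_def by blast
  next
    case 2
    have o: "om x \<in> G (- k)" "om (om x) = x" using om_G om_om x assms by auto
    then have "om x \<noteq> 0" using x(2) by auto
    then have "0 < sqn (om x)" using posdef_pos[OF 2] o(1) unfolding posdef_def by blast
    moreover have "sqn (om x) = sqn x" unfolding sqn_def hf_def o(2) by (simp add: Bf_sym)
    ultimately show ?thesis by simp
  qed
qed

section \<open>Brackets of root vectors\<close>

text \<open>Leibniz on [y, [om x, om y]] produces [om x, [y, om y]], a multiple of
  \<open>om x\<close> and the source of (k|l). The terms are left as values of \<open>Bf\<close>,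
  because for k = l the bracket [x, om y] lies in \<open>H\<close>, where \<open>om\<close> is not
  controlled.\<close>

lemma sqn_br:
  assumes x: "x \<in> G k" "k \<noteq> 0" and y: "y \<in> G l" "l \<noteq> 0"
  shows "- Bf (br x y) (br (om x) (om y))
    = Bf (br x (om y)) (br y (om x)) - of_real (ip k l * sqn x * sqn y)"
proof -
  have ox: "om x \<in> G (- k)" and oy: "om y \<in> G (- l)" using om_G x y by auto
  have 1: "br (om x) (br y (om y)) = sc (- Bf y (om y)) (br (tv l) (om x))"
    using br_opposite[OF y(1) oy] br_anti[of "om x" "tv l"] by (simp add: br_sc_r)
  have 2: "br (tv l) (om x) = sc (- of_real (ip k l)) (om x)"
    using br_tv[OF ox, of l] by (simp add: ip_minus_l ip_sym[of l] ip_sym[of "- k"])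
  have 3: "Bf x (om x) = - of_real (sqn x)" "Bf y (om y) = - of_real (sqn y)"
    unfolding hf_self[OF x, symmetric] hf_self[OF y, symmetric] by (simp_all add: hf_def)
  have 4: "Bf x (br (br y (om x)) (om y)) = - Bf (br x (om y)) (br y (om x))"
    unfolding Bf_inv[of x "om y"] using br_anti[of "om y"] by (simp add: Bf_minus_r)
  show ?thesis
    unfolding Bf_inv[of x y] br_leibniz[of y] Bf_add_r 1 2 4 by (simp add: Bf_sc_r Bf_minus_r 3)
qed

theorem br_nonzero:
  assumes x: "x \<in> G k" "k \<noteq> 0" "x \<noteq> 0" and y: "y \<in> G l" "l \<noteq> 0" "y \<noteq> 0"
    and neg: "ip k l < 0" and indep: "\<And>c. c \<noteq> 0 \<Longrightarrow> x \<noteq> sc c y"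
  shows "br x y \<noteq> 0"
proof
  assume 0: "br x y = 0"
  have nx: "0 < sqn x" and ny: "0 < sqn y"
    using posdef_root x y unfolding posdef_def by blast+
  have oy: "om y \<in> G (- l)" "om (om y) = y" using om_G om_om y by auto
  have key: "Bf (br x (om y)) (br y (om x)) = of_real (ip k l * sqn x * sqn y)"
    using sqn_br[OF x(1,2) y(1,2)] 0 by simp
  have pos: "0 < - (ip k l * sqn x * sqn y)" using neg nx ny by (simp add: mult_neg_pos)
  show False
  proof (cases "k = l")
    case False
    have G: "br x (om y) \<in> G (k - l)" using G_br[OF x(1) oy(1)] by simp
    \<comment> \<open>For distinct weights the left side of \<open>key\<close> is a norm, which
      cannot be negative.\<close>
    have "om (br x (om y)) = br (om x) y" using om_br[OF x(1) oy(1)] x(2) y(2) oy(2) by simp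
    then have "hf (br x (om y)) (br x (om y)) = Bf (br x (om y)) (br y (om x))"
      using br_anti[of "om x" y] by (simp add: hf_def Bf_minus_r)
    then have "sqn (br x (om y)) = ip k l * sqn x * sqn y" using key by (simp add: sqn_def)
    moreover have "0 \<le> sqn (br x (om y))"
    proof (cases "br x (om y) = 0")
      case True
      then show ?thesis by (simp add: sqn_def)
    next
      case False
      then show ?thesis using posdef_root[of "k - l"] G \<open>k \<noteq> l\<close> unfolding posdef_def by force
    qed
    ultimately show False using pos by linarith
  next
    case True
    have yk: "y \<in> G k" and ox: "om x \<in> G (- k)" and oyk: "om y \<in> G (- k)"
      using True y(1) om_G[OF x(1,2)] oy by auto
    \<comment> \<open>Both brackets are multiples of \<open>tv k\<close>, so the identity becomes
      equality in Cauchy-Schwarz.\<close>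
    have "Bf (br x (om y)) (br y (om x)) = hf x y * hf y x * of_real (ip k k)"
      using br_opposite[OF x(1) oyk] br_opposite[OF yk ox]
      by (simp add: Bf_sc_l Bf_sc_r Bf_tv_tv hf_def)
    also have "hf x y * hf y x = of_real ((cmod (hf x y))\<^sup>2)"
      using hf_sym[OF x(1) yk x(2)] by (simp add: complex_norm_square[symmetric])
    finally have "(of_real (ip k l * sqn x * sqn y) :: complex) = of_real ((cmod (hf x y))\<^sup>2 * ip k k)"
      unfolding key by simp
    then have "ip k l * (sqn x * sqn y) = ip k l * (cmod (hf x y))\<^sup>2"
      using True unfolding of_real_eq_iff by simp
    then have cs: "(cmod (hf x y))\<^sup>2 = sqn x * sqn y"
      using neg by simp
    \<comment> \<open>This is \<open>sqn y\<close> times the part of \<open>x\<close> orthogonal to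
      \<open>y\<close>. It turns out orthogonal to both vectors, hence of norm zero, although
      independence makes it nonzero.\<close>
    define z where "z = sc (of_real (sqn y)) x - sc (hf x y) y"
    have z: "z \<in> G k" unfolding z_def
      using x(1) yk subspace_diff[OF subspace_G] subspace_scale[OF subspace_G] by blast
    have zy: "hf z y = 0"
      using hf_self[OF yk x(2)] by (simp add: z_def hf_diff_l hf_sc_l)
    have hfx: "hf x y \<noteq> 0" using cs nx ny by auto
    have "z \<noteq> 0"
    proof
      assume "z = 0"
      then have "sc (of_real (sqn y)) x = sc (hf x y) y" by (simp add: z_def)
      moreover have "x = sc (inverse (of_real (sqn y))) (sc (of_real (sqn y)) x)" using ny by simp
      ultimately have "x = sc (inverse (of_real (sqn y)) * hf x y) y" by simp
      then show False using indep[of "inverse (of_real (sqn y)) * hf x y"] hfx ny by simp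
    qed
    then have "0 < sqn z" using posdef_root[OF x(2)] z unfolding posdef_def by blast
    moreover have "hf z z = of_real (sqn y) * hf z x"
      using zy z x yk
      unfolding z_def[THEN arg_cong[where f = "hf z"]]
      by (simp add: hf_diff_r[of z k] hf_sc_r[of z k] subspace_scale[OF subspace_G])
    moreover have "hf z x = 0"
    proof -
      have "hf z x = of_real (sqn y) * hf x x - hf x y * hf y x"
        by (simp add: z_def hf_diff_l hf_sc_l)
      also have "hf x y * hf y x = of_real ((cmod (hf x y))\<^sup>2)"
        using hf_sym[OF x(1) yk x(2)] by (simp add: complex_norm_square[symmetric])
      finally show ?thesis using hf_self[OF x(1,2)] by (simp add: cs)
    qed
    ultimately show False by (simp add: sqn_def)
  qed
qed

section \<open>Return to the given definitions\<close>

lemma nu_inv_eq: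
  assumes "\<And>h. h \<in> H \<Longrightarrow> a h = wt k h"
  shows "nu_inv H Bf a = tv k"
  unfolding nu_inv_def
proof (rule the_equality)
  show "tv k \<in> H \<and> (\<forall>h\<in>H. Bf (tv k) h = a h)"
    using assms tv_H Bf_tv by simp
next
  fix t assume t: "t \<in> H \<and> (\<forall>h\<in>H. Bf t h = a h)"
  have "t - tv k \<in> H" using t tv_H subspace_diff[OF H_subspace] by blast
  moreover have "Bf (t - tv k) h = 0" if "h \<in> H" for h
    using t assms[OF that] Bf_tv[OF that] that by (simp add: Bf_diff_l)
  ultimately show "t = tv k" using Bf_nondeg_H by (metis right_minus_eq)
qed

end

lemma kac_moody_form_intro:
  assumes "gcm A" and "kac_moody A sc br H alpha coroot e f" and "standard_form sc br H alpha coroot Bf"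
  obtains eps where "kac_moody_form sc A br H alpha coroot e f Bf eps"
proof -
  have lie: "lie_algebra sc br" and real: "realization A sc H alpha coroot"
    and ef: "\<forall>i j. br (e i) (f j) = (if i = j then coroot i else 0)"
    and HH: "\<forall>h\<in>H. \<forall>k\<in>H. br h k = 0"
    and He: "\<forall>i. \<forall>h\<in>H. br h (e i) = sc (alpha i h) (e i)"
    and Hf: "\<forall>i. \<forall>h\<in>H. br h (f i) = sc (- alpha i h) (f i)"
    and gen: "\<forall>S. lie_subalgebra sc br S \<and> H \<subseteq> S \<and> range e \<subseteq> S \<and> range f \<subseteq> S \<longrightarrow> S = UNIV"
    and ideal: "\<forall>J. lie_ideal sc br J \<and> J \<inter> H = {0} \<longrightarrow> J = {0}"
    using assms(2) unfolding kac_moody_def by - (elim conjE, assumption)+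
  have "\<exists>eps::'a \<Rightarrow> real. (\<forall>i. eps i > 0) \<and> (\<forall>i. \<forall>h\<in>H. Bf (coroot i) h = of_real (eps i) * alpha i h)"
    using assms(3) unfolding standard_form_def by (elim conjE)
  then obtain eps :: "'a \<Rightarrow> real"
    where eps: "\<forall>i. 0 < eps i" "\<forall>i. \<forall>h\<in>H. Bf (coroot i) h = of_real (eps i) * alpha i h"
    by blast
  have vs: "vector_space sc"
    and lie': "\<forall>x y z. br (x + y) z = br x z + br y z" "\<forall>x y z. br x (y + z) = br x y + br x z"
      "\<forall>a x y. br (sc a x) y = sc a (br x y)" "\<forall>a x y. br x (sc a y) = sc a (br x y)"
      "\<forall>x. br x x = 0" "\<forall>x y z. br x (br y z) + br y (br z x) + br z (br x y) = 0"
    using lie unfolding lie_algebra_def by - (elim conjE, assumption)+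
  have sub: "module.subspace sc H"
    and alpha: "\<forall>i. \<forall>h\<in>H. \<forall>k\<in>H. \<forall>c. alpha i (h + k) = alpha i h + alpha i k \<and> alpha i (sc c h) = c * alpha i h"
    and alpha_indep: "\<forall>c. (\<forall>h\<in>H. (\<Sum>i\<in>UNIV. c i * alpha i h) = 0) \<longrightarrow> (\<forall>i. c i = 0)"
    and coroot: "\<forall>i. coroot i \<in> H"
    and coroot_indep: "\<forall>c. (\<Sum>i\<in>UNIV. sc (c i) (coroot i)) = 0 \<longrightarrow> (\<forall>i. c i = 0)"
    and alpha_coroot: "\<forall>i j. alpha j (coroot i) = of_int (A i j)"
    using real unfolding realization_def by - (elim conjE, assumption)+
  have Bf: "\<forall>x y z. Bf (x + y) z = Bf x z + Bf y z" "\<forall>a x y. Bf (sc a x) y = a * Bf x y"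
      "\<forall>x y. Bf x y = Bf y x" "\<forall>x y z. Bf (br x y) z = Bf x (br y z)"
      "\<forall>x\<in>H. (\<forall>y\<in>H. Bf x y = 0) \<longrightarrow> x = 0"
    using assms(3) unfolding standard_form_def by - (elim conjE, assumption)+
  interpret vector_space sc by (rule vs)
  have "kac_moody_form sc A br H alpha coroot e f Bf eps"
  proof (unfold_locales, goal_cases)
    case 7 show ?case by (rule sub)
  next
    case 8 then show ?case using alpha by blast
  next
    case 9 then show ?case using alpha by blast
  next
    case 10 then show ?case using alpha_indep by blast
  next
    case 12 then show ?case using coroot_indep by blast
  next
    case 18 then show ?case using gen by simp
  next
    case 19 then show ?case using ideal by simp
  next
    case 20 show ?case using assms(1) unfolding gcm_def by blast
  next
    case 21 then show ?case using assms(1) unfolding gcm_def by blast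
  next
    case 22 then show ?case using assms(1) unfolding gcm_def by blast
  next
    case 25 show ?case using Bf(3) by blast
  next
    case 27 then show ?case using Bf(5) by blast
  qed (rule lie'[rule_format] Bf(1,2,4)[rule_format] coroot[rule_format] alpha_coroot[rule_format]
      ef[rule_format] HH[rule_format] He[rule_format] Hf[rule_format] eps[rule_format]; assumption)+
  then show ?thesis using that by blast
qed

theorem theorem4p4:
  fixes A :: "'i::finite \<Rightarrow> 'i \<Rightarrow> int"
    and sc :: "complex \<Rightarrow> 'g::ab_group_add \<Rightarrow> 'g"
    and br :: "'g \<Rightarrow> 'g \<Rightarrow> 'g"
    and H :: "'g set"
    and alpha :: "'i \<Rightarrow> 'g \<Rightarrow> complex"
    and coroot e f :: "'i \<Rightarrow> 'g"
    and Bf :: "'g \<Rightarrow> 'g \<Rightarrow> complex"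
    and a b :: "'g \<Rightarrow> complex"
  assumes "gcm A" and "symmetrisable A"
    and "kac_moody A sc br H alpha coroot e f"
    and "standard_form sc br H alpha coroot Bf"
    and "a \<in> roots sc br H" and "b \<in> roots sc br H"
    and "form_star H Bf a b \<in> \<real>" and "Re (form_star H Bf a b) < 0"
  shows "\<forall>x\<in>root_space sc br H a. \<forall>y\<in>root_space sc br H b.
           x \<noteq> 0 \<and> y \<noteq> 0 \<and> {sc c x | c. True} \<noteq> {sc c y | c. True} \<longrightarrow> br x y \<noteq> 0"
proof (intro ballI impI)
  fix x y
  assume x: "x \<in> root_space sc br H a" and y: "y \<in> root_space sc br H b"
    and xy: "x \<noteq> 0 \<and> y \<noteq> 0 \<and> {sc c x | c. True} \<noteq> {sc c y | c. True}"
  obtain eps where "kac_moody_form sc A br H alpha coroot e f Bf eps"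
    using kac_moody_form_intro assms(1,3,4) by blast
  then interpret kac_moody_form sc A br H alpha coroot e f Bf eps .
  obtain k where k: "\<And>h. h \<in> H \<Longrightarrow> a h = wt k h" "x \<in> W k"
    using root_space_W[OF x] xy by blast
  obtain l where l: "\<And>h. h \<in> H \<Longrightarrow> b h = wt l h" "y \<in> W l"
    using root_space_W[OF y] xy by blast
  have k0: "k \<noteq> 0" using assms(5) k(1) unfolding roots_def by auto
  have l0: "l \<noteq> 0" using assms(6) l(1) unfolding roots_def by auto
  have "form_star H Bf a b = of_real (ip k l)"
    unfolding form_star_def using nu_inv_eq[OF k(1)] nu_inv_eq[OF l(1)] Bf_tv_tv ip_sym by metis
  then have "ip k l < 0" using assms(8) by simp
  moreover have "x \<noteq> sc c y" if c: "c \<noteq> 0" for c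
  proof
    assume xc: "x = sc c y"
    have "sc d x = sc (d * c) y" "sc d y = sc (d / c) x" for d
      using c by (simp_all add: xc)
    then have "{sc c x | c. True} = {sc c y | c. True}" by blast
    then show False using xy by blast
  qed
  ultimately show "br x y \<noteq> 0"
    using br_nonzero[of x k y l] k(2) l(2) k0 l0 xy by (simp add: G_eq_W)
qed

end
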